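(* Let $d \geq 2$ be an integer and $T$ a tree of order $n$. Then $\gamma_d^1(T)=\frac{n}{d+1}$ if and only if $n=d+1$ or $T \in \mathcal{T}_d$.
   Context: $P_d$ is the path on $d$ vertices. The $P_d$-corona $T^*\circ P_d$ of a graph $T^*$ is obtained from $T^*$ and $|V(T^* )|$ disjoint copies of $P_d$ by joining each vertex $v$ of $T^*$ by an edge to an end vertex of its own copy of $P_d$. $\mathcal{T}_d=\{T^*\circ P_d : T^* \text{ is a tree with at least two vertices}\}$. $\gamma_d^1(G)$ is the minimum size of an independent set $S\subseteq V(G)$ such that every vertex not in $S$ is at distance at most $d$ from some vertex of $S$. *)

theory Defs
  imports "Graph_Theory.Graph_Theory"
begin

text \<open>
  Finite simple undirected graphs are rendered by the locale \<open>pair_graph\<close>: finite loop-free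
  digraphs with a symmetric set of arcs, which are pairs of vertices.

  The library's \<open>tree\<close> is meant for digraphs: a symmetric digraph with an edge uv has the directed
  cycle u, v, u, so it is never a \<open>tree\<close>. The cycles of an undirected graph are the directed
  cycles of length at least 3 of the corresponding symmetric digraph.
\<close>

definition undirected_tree :: "'a pair_pre_digraph \<Rightarrow> bool" where
  "undirected_tree G \<longleftrightarrow>
     pair_graph G \<and> connected (with_proj G) \<and>
     \<not> (\<exists>p. pre_digraph.cycle (with_proj G) p \<and> 3 \<le> length p)"

text \<open>The value is \<open>\<infinity>\<close> if the two vertices lie in different components.\<close>

definition graph_dist :: "'a pair_pre_digraph \<Rightarrow> 'a \<Rightarrow> 'a \<Rightarrow> ereal" where
  "graph_dist G u v = wf_digraph.\<mu> (with_proj G) (\<lambda>_. 1) u v"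

definition independent_set :: "'a pair_pre_digraph \<Rightarrow> 'a set \<Rightarrow> bool" where
  "independent_set G S \<longleftrightarrow> S \<subseteq> pverts G \<and> (\<forall>u\<in>S. \<forall>v\<in>S. (u, v) \<notin> parcs G)"

definition dist_dominating :: "'a pair_pre_digraph \<Rightarrow> nat \<Rightarrow> 'a set \<Rightarrow> bool" where
  "dist_dominating G d S \<longleftrightarrow>
     S \<subseteq> pverts G \<and> (\<forall>v\<in>pverts G - S. \<exists>u\<in>S. graph_dist G v u \<le> ereal (real d))"

text \<open>
  For \<open>d \<ge> 1\<close> every finite graph has an independent set as required (any maximal one), so that the
  minimum is taken over a nonempty finite set.
\<close>

definition indep_dist_domination_number :: "nat \<Rightarrow> 'a pair_pre_digraph \<Rightarrow> nat" where
  "indep_dist_domination_number d G =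
     Min (card ` {S. independent_set G S \<and> dist_dominating G d S})"

definition path_graph :: "nat \<Rightarrow> nat pair_pre_digraph" where
  "path_graph d =
     \<lparr> pverts = {..<d},
       parcs = {(i, j). i < d \<and> j < d \<and> (j = Suc i \<or> i = Suc j)} \<rparr>"

text \<open>
  In the corona \<open>Inl v\<close> is the vertex \<open>v\<close> of \<open>G\<close>, and \<open>Inr (v, i)\<close> is the vertex \<open>i\<close> in the copy of
  the path that belongs to \<open>v\<close>. The end vertex joined to \<open>v\<close> is 0, so \<open>d \<ge> 1\<close> is needed.
\<close>

definition path_corona :: "'a pair_pre_digraph \<Rightarrow> nat \<Rightarrow> ('a + 'a \<times> nat) pair_pre_digraph" where
  "path_corona G d =
     \<lparr> pverts = Inl ` pverts G \<union> Inr ` (pverts G \<times> pverts (path_graph d)),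
       parcs = {(Inl u, Inl v) | u v. (u, v) \<in> parcs G}
             \<union> {(Inr (v, i), Inr (v, j)) | v i j. v \<in> pverts G \<and> (i, j) \<in> parcs (path_graph d)}
             \<union> {(Inl v, Inr (v, 0)) | v. v \<in> pverts G}
             \<union> {(Inr (v, 0), Inl v) | v. v \<in> pverts G} \<rparr>"

text \<open>
  Membership is up to isomorphism. Taking the base tree over the vertex type of \<open>T\<close> loses
  nothing, as a graph isomorphic to a corona of \<open>G\<close> contains a copy of \<open>G\<close>.
\<close>

definition path_coronas :: "nat \<Rightarrow> 'a pair_pre_digraph set" where
  "path_coronas d =
     {T. \<exists>G :: 'a pair_pre_digraph.
           undirected_tree G \<and> 2 \<le> card (pverts G) \<and>
           digraph_iso (with_proj T) (with_proj (path_corona G d))}"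

end

(*
  Root the tree at an end r of a longest path. For 0 <= i <= d the vertices whose level is
  congruent to i modulo d + 1 form an independent d-dominating set, unless all levels are below d.
  These sets partition the tree, so if n = k (d + 1) with k the domination number, then each of
  them has exactly k elements. If a vertex q with no descendant more than d levels below it had two
  children, then replacing in one of these sets all children of q by q would give a smaller
  independent d-dominating set. Hence below the d-th ancestor v of a deepest vertex the tree is a
  path on d + 1 vertices. Removing it leaves an extremal tree for k - 1, for which r still has the
  property of the root that was used; by induction this is a corona. The parent of v must be a base
  vertex: otherwise v, a base neighbour b of the base vertex of that column and the far ends of the
  remaining columns would form a set of only k - 1 vertices.
*)

theory Submission
  imports Defs
begin

text \<open>The induction cannot start at k = 1: every tree on d + 1 vertices is extremal there,
  whatever its shape. The first usable case is k = 2, where the remainder left by the removed path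
  must be shown to be a path attached by an end; this takes its own argument, and it uses the choice
  of the root once more. To keep isomorphisms out of the induction, a corona is described inside the
  given tree by coordinates, a base vertex and a height in its column. The base set is turned into a
  tree of its own only when the final coordinates are known. For the converse, whatever lies within
  distance d of the far end of a column lies in that column, so distinct columns need distinct
  members of a dominating set.\<close>

section \<open>Rooted trees given by a parent function\<close>

text \<open>
  A rooted tree is a finite set with a parent function \<open>p\<close> fixing the root, so that iterating \<open>p\<close>
  beyond the root is harmless, and \<open>near p m u w\<close> says that the distance of \<open>u\<close> and \<open>w\<close> is at
  most \<open>m\<close>. No vertex set is involved, which makes it invariant under pruning.
\<close>

definition near :: "('a \<Rightarrow> 'a) \<Rightarrow> nat \<Rightarrow> 'a \<Rightarrow> 'a \<Rightarrow> bool" where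
  "near p m u w \<longleftrightarrow> (\<exists>a b. a + b \<le> m \<and> (p ^^ a) u = (p ^^ b) w)"

definition padj :: "('a \<Rightarrow> 'a) \<Rightarrow> 'a \<Rightarrow> 'a \<Rightarrow> bool" where
  "padj p u w \<longleftrightarrow> u \<noteq> w \<and> (p u = w \<or> p w = u)"

definition indep_dom :: "('a \<Rightarrow> 'a) \<Rightarrow> nat \<Rightarrow> 'a set \<Rightarrow> 'a set \<Rightarrow> bool" where
  "indep_dom p d V S \<longleftrightarrow>
     S \<subseteq> V \<and> (\<forall>u\<in>S. \<forall>w\<in>S. \<not> padj p u w) \<and> (\<forall>v\<in>V. \<exists>s\<in>S. near p d v s)"

text \<open>\<open>f b i\<close> is the vertex at distance \<open>i\<close> from the base vertex \<open>b\<close> on the path pending from \<open>b\<close>.\<close>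

definition corona_coords :: "('a \<Rightarrow> 'a) \<Rightarrow> nat \<Rightarrow> 'a set \<Rightarrow> 'a set \<Rightarrow> ('a \<Rightarrow> nat \<Rightarrow> 'a) \<Rightarrow> bool" where
  "corona_coords p d V B f \<longleftrightarrow>
     bij_betw (\<lambda>(b, i). f b i) (B \<times> {..d}) V \<and> (\<forall>b\<in>B. f b 0 = b) \<and>
     (\<forall>b\<in>B. \<forall>c\<in>B. \<forall>i\<le>d. \<forall>j\<le>d. padj p (f b i) (f c j) \<longleftrightarrow>
        b = c \<and> (i = Suc j \<or> j = Suc i) \<or> i = 0 \<and> j = 0 \<and> padj p b c)"

section \<open>Elementary rules for bounded distance and parent adjacency\<close>

lemma padj_sym: "padj p u w \<Longrightarrow> padj p w u"
  by (auto simp: padj_def)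

lemma near_refl [simp]: "near p m u u"
  unfolding near_def by (rule exI[of _ 0], rule exI[of _ 0]) simp

lemma near_sym: "near p m u w \<Longrightarrow> near p m w u"
  unfolding near_def by (metis add.commute)

lemma near_mono: "near p m u w \<Longrightarrow> m \<le> n \<Longrightarrow> near p n u w"
  unfolding near_def by (meson le_trans)

lemma near_funpow: "(p ^^ a) u = w \<Longrightarrow> a \<le> m \<Longrightarrow> near p m u w"
  unfolding near_def by (rule exI[of _ a], rule exI[of _ 0]) simp

text \<open>\<open>(p ^^ b) v\<close> and \<open>(p ^^ c) v\<close> are both ancestors of
  \<open>v\<close>, so one lies above the other. The side that stopped at the lower one climbs on to
  the higher one; these extra steps are covered by those counted from \<open>v\<close>.\<close>

lemma near_trans:
  assumes "near p m u v" "near p n v w"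
  shows "near p (m + n) u w"
proof -
  obtain a b where ab: "a + b \<le> m" "(p ^^ a) u = (p ^^ b) v"
    using assms(1) by (auto simp: near_def)
  obtain c e where ce: "c + e \<le> n" "(p ^^ c) v = (p ^^ e) w"
    using assms(2) by (auto simp: near_def)
  show ?thesis
  proof (cases "c \<le> b")
    case True
    have "(p ^^ a) u = (p ^^ ((b - c) + c)) v" using ab True by simp
    also have "\<dots> = (p ^^ (b - c)) ((p ^^ e) w)" by (simp only: funpow_add o_apply ce)
    also have "\<dots> = (p ^^ (b - c + e)) w" by (simp add: funpow_add)
    finally show ?thesis using ab(1) ce(1) True unfolding near_def
      by (intro exI[of _ a] exI[of _ "b - c + e"]) simp
  next
    case False
    have "(p ^^ e) w = (p ^^ ((c - b) + b)) v" using ce False by simp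
    also have "\<dots> = (p ^^ (c - b)) ((p ^^ a) u)" by (simp only: funpow_add o_apply ab)
    also have "\<dots> = (p ^^ (c - b + a)) u" by (simp add: funpow_add)
    finally show ?thesis using ab(1) ce(1) False unfolding near_def
      by (intro exI[of _ "c - b + a"] exI[of _ e]) simp
  qed
qed

lemma near_padj: "padj p u w \<Longrightarrow> near p 1 u w"
  using near_funpow[of 1 p u w 1] near_sym[OF near_funpow[of 1 p w u 1]] by (auto simp: padj_def)

lemma near_Suc: "near p m u v \<Longrightarrow> padj p v w \<Longrightarrow> near p (Suc m) u w"
  using near_trans[of p m u v 1 w] near_padj[of p v w] by simp

lemma near_chain:
  assumes "\<And>i. i < d \<Longrightarrow> padj p (f i) (f (Suc i))" "i \<le> j" "j \<le> d"
  shows "near p (j - i) (f i) (f j)"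
  using assms(2,3)
proof (induction j rule: dec_induct)
  case base then show ?case by simp
next
  case (step j)
  then have "near p (Suc (j - i)) (f i) (f (Suc j))"
    using near_Suc[of p "j - i" "f i" "f j" "f (Suc j)"] assms(1)[of j] by simp
  then show ?case using step by (simp add: Suc_diff_le)
qed

lemma add_mod_neq:
  fixes x j m :: nat
  assumes "0 < j" "j < m"
  shows "(x + j) mod m \<noteq> x mod m"
proof
  assume "(x + j) mod m = x mod m"
  then have "m dvd (x + j) - x" by (subst (asm) mod_eq_dvd_iff_nat) auto
  then show False using assms nat_dvd_not_less[of j m] by simp
qed

text \<open>Meant for the sizes of the d + 1 level classes: each is at least the domination number,
  and in the extremal case their total leaves no slack.\<close>

lemma sum_eq_const_imp:
  fixes g :: "nat \<Rightarrow> nat"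
  assumes "\<And>i. i \<le> d \<Longrightarrow> k \<le> g i" "(\<Sum>i\<le>d. g i) = k * Suc d" "i \<le> d"
  shows "g i = k"
proof -
  have "(\<Sum>i\<le>d. k) = (\<Sum>i\<le>d. g i)" using assms(2) by (simp add: mult.commute)
  from sum_mono_inv[OF this, of i] assms show ?thesis by simp
qed

text \<open>Levels drop by one along \<open>p\<close>, which excludes cycles of \<open>p\<close>
  other than the loop at \<open>r\<close> and makes \<open>r\<close> the vertex reached from
  \<open>v\<close> after \<open>l v\<close> steps.\<close>

locale rooted_tree =
  fixes V :: "'a set" and r :: 'a and p :: "'a \<Rightarrow> 'a" and l :: "'a \<Rightarrow> nat"
  assumes finite_V: "finite V" and root_in: "r \<in> V" and parent_root: "p r = r"
    and level_root: "l r = 0"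
    and parent_in: "v \<in> V \<Longrightarrow> v \<noteq> r \<Longrightarrow> p v \<in> V"
    and level_parent: "v \<in> V \<Longrightarrow> v \<noteq> r \<Longrightarrow> l v = Suc (l (p v))"
begin

lemma parent_in': "v \<in> V \<Longrightarrow> p v \<in> V"
  using parent_in parent_root by metis

lemma ancestor_in: "v \<in> V \<Longrightarrow> (p ^^ a) v \<in> V"
  by (induction a) (auto simp: parent_in')

lemma level_0_iff: "v \<in> V \<Longrightarrow> l v = 0 \<longleftrightarrow> v = r"
  using level_root level_parent[of v] by (cases "v = r") auto

lemma level_parent': "v \<in> V \<Longrightarrow> l (p v) = l v - 1"
  using level_parent[of v] parent_root level_root by (cases "v = r") auto

lemma level_ancestor: "v \<in> V \<Longrightarrow> l ((p ^^ a) v) = l v - a"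
  by (induction a) (auto simp: level_parent' ancestor_in)

lemma ancestor_root: "v \<in> V \<Longrightarrow> l v \<le> a \<Longrightarrow> (p ^^ a) v = r"
  using level_ancestor[of v a] level_0_iff[OF ancestor_in[of v a]] by simp

lemma padj_level:
  assumes "u \<in> V" "w \<in> V" "padj p u w"
  shows "l u = Suc (l w) \<and> p u = w \<or> l w = Suc (l u) \<and> p w = u"
  using assms level_parent[of u] level_parent[of w] parent_root
  by (cases "u = r"; cases "w = r") (auto simp: padj_def)

lemma padj_parent: "v \<in> V \<Longrightarrow> v \<noteq> r \<Longrightarrow> padj p v (p v)"
  using level_parent[of v] by (auto simp: padj_def)

lemma root_indep_dom:
  assumes "\<And>v. v \<in> V \<Longrightarrow> l v \<le> d"
  shows "indep_dom p d V {r}"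
proof -
  have "near p d v r" if "v \<in> V" for v
    using near_funpow[of d p v r d] ancestor_root[OF that] assms[OF that] by simp
  then show ?thesis using root_in by (auto simp: indep_dom_def padj_def)
qed

end

section \<open>Level classes of a tree rooted at an end of a longest path\<close>

text \<open>
  The condition \<open>near_level\<close> holds when the root is an end of a longest path. Unlike that property,
  it is inherited by all subtrees containing the root.
\<close>

locale end_rooted_tree = rooted_tree +
  assumes near_level: "u \<in> V \<Longrightarrow> w \<in> V \<Longrightarrow> near p (max (l u) (l w)) u w"
begin

definition level_class :: "nat \<Rightarrow> nat \<Rightarrow> 'a set" where
  "level_class d i = {v \<in> V. l v mod Suc d = i}"

lemma card_level_classes: "(\<Sum>i\<le>d. card (level_class d i)) = card V"
proof -
  have "V = (\<Union>i\<le>d. level_class d i)"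
    by (auto simp: level_class_def simp flip: less_Suc_eq_le)
  moreover have "card (\<Union>i\<in>{..d}. level_class d i) = (\<Sum>i\<le>d. card (level_class d i))"
    by (rule card_UN_disjoint) (auto simp: level_class_def finite_V)
  ultimately show ?thesis by simp
qed

lemma ancestor_in_class:
  assumes "v \<in> V" "i \<le> d" "i \<le> l v"
  obtains a where "a \<le> d" "(p ^^ a) v \<in> level_class d i"
proof
  \<comment> \<open>Climbing by this remainder leads to level i plus a multiple of d + 1;
    \<open>i \<le> l v\<close> keeps the subtraction exact.\<close>
  let ?a = "(l v - i) mod Suc d"
  show "?a \<le> d" using mod_less_divisor[of "Suc d" "l v - i"] by linarith
  have "l v - ?a = i + (l v - i) div Suc d * Suc d"
    using div_mult_mod_eq[of "l v - i" "Suc d"] assms(3) by linarith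
  then have "(l v - ?a) mod Suc d = i"
    using assms(2) by (simp only: mod_mult_self1) simp
  then show "(p ^^ ?a) v \<in> level_class d i"
    unfolding level_class_def using ancestor_in level_ancestor assms(1) by simp
qed

lemma level_exists:
  assumes "z \<in> V" "i \<le> l z"
  obtains y where "y \<in> V" "l y = i"
proof
  show "(p ^^ (l z - i)) z \<in> V" by (rule ancestor_in[OF assms(1)])
  show "l ((p ^^ (l z - i)) z) = i" using level_ancestor[OF assms(1)] assms(2) by simp
qed

lemma level_class_indep:
  assumes "1 \<le> d" "u \<in> level_class d i" "w \<in> level_class d i"
  shows "\<not> padj p u w"
proof
  assume "padj p u w"
  then have "l u = Suc (l w) \<or> l w = Suc (l u)"
    using padj_level assms by (auto simp: level_class_def)
  moreover have "l u mod Suc d = l w mod Suc d" using assms by (simp add: level_class_def)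
  ultimately show False
    using \<open>1 \<le> d\<close> add_mod_neq[of 1 "Suc d" "l u"] add_mod_neq[of 1 "Suc d" "l w"] by auto
qed

text \<open>A vertex of level at least i finds a member of class i among itself and its d nearest
  ancestors. A vertex of smaller level has none above it, but by \<open>near_level\<close> it is
  within i of every vertex on level i. The vertex \<open>z\<close> ensures that this level is
  inhabited.\<close>

lemma level_class_indep_dom:
  assumes "1 \<le> d" "i \<le> d" "z \<in> V" "d \<le> l z"
  shows "indep_dom p d V (level_class d i)"
proof -
  have "\<exists>s\<in>level_class d i. near p d v s" if v: "v \<in> V" for v
  proof (cases "i \<le> l v")
    case True
    then show ?thesis using ancestor_in_class[OF v assms(2)] near_funpow by metis
  next
    case False
    obtain y where y: "y \<in> V" "l y = i" using level_exists assms by (metis le_trans)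
    then have "near p d v y" using near_mono[OF near_level[OF v y(1)]] False assms(2) by simp
    moreover have "y \<in> level_class d i" using y assms(2) by (simp add: level_class_def)
    ultimately show ?thesis by blast
  qed
  then show ?thesis using level_class_indep[OF assms(1)]
    unfolding indep_dom_def by (auto simp: level_class_def)
qed

definition children :: "'a \<Rightarrow> 'a set" where
  "children q = {c \<in> V. c \<noteq> r \<and> p c = q}"

text \<open>
  Here \<open>d \<ge> 2\<close> is essential: the parent of \<open>q\<close> lies two levels above the class in question, hence
  outside of it.
\<close>

lemma replace_children_indep_dom:
  assumes d: "2 \<le> d" and z: "z \<in> V" "d \<le> l z" and q: "q \<in> V"
    and height: "\<And>w a. w \<in> V \<Longrightarrow> (p ^^ a) w = q \<Longrightarrow> a \<le> d"
  shows "indep_dom p d V (insert q (level_class d (Suc (l q) mod Suc d) - children q))"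
    (is "indep_dom p d V ?S")
proof -
  define i where "i = Suc (l q) mod Suc d"
  have i: "i \<le> d" using mod_less_divisor[of "Suc d"] by (simp add: i_def less_Suc_eq_le)
  have qr: "q \<noteq> r"
    using height[of r "Suc d"] root_in ancestor_root[OF root_in, of "Suc d"] level_root by auto
  have "\<exists>s\<in>insert q (level_class d i - children q). near p d v s" if v: "v \<in> V" for v
  proof (cases "i \<le> l v")
    case True
    obtain a where a: "a \<le> d" "(p ^^ a) v \<in> level_class d i"
      using ancestor_in_class[OF v i True] by blast
    show ?thesis
    proof (cases "(p ^^ a) v \<in> children q")
      case True
      \<comment> \<open>The deleted child is one step below \<open>q\<close>, and
        \<open>height\<close> bounds the whole climb from \<open>v\<close> to \<open>q\<close> by d,
        so \<open>q\<close> takes over the descendants that its children served.\<close>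
      then have "(p ^^ Suc a) v = q" by (simp add: children_def)
      then show ?thesis using height[OF v] near_funpow[of "Suc a" p v q d] by blast
    next
      case False
      then show ?thesis using a near_funpow[of a p v _ d] by blast
    qed
  next
    case False
    obtain y where y: "y \<in> V" "l y = i" using level_exists z i by (metis le_trans)
    show ?thesis
    proof (cases "y \<in> children q")
      case True
      \<comment> \<open>\<open>y\<close> is on level i itself, hence \<open>q\<close> on level i -
        1; as \<open>v\<close> is also above level i, \<open>near_level\<close> applies to
        \<open>v\<close> and \<open>q\<close>.\<close>
      then have "l q < i" using y level_parent[of y] by (auto simp: children_def)
      then have "near p d v q" using near_mono[OF near_level[OF v q], of d] False i by simp
      then show ?thesis by blast
    next
      case nc: False
      then have "y \<in> insert q (level_class d i - children q)" using y i by (simp add: level_class_def)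
      moreover have "near p d v y"
        using near_mono[OF near_level[OF v y(1)]] False y(2) i by simp
      ultimately show ?thesis by blast
    qed
  qed
  moreover have "\<not> padj p q s" if s: "s \<in> level_class d i - children q" for s
  proof
    assume a: "padj p q s"
    have sV: "s \<in> V" "l s mod Suc d = i" using s by (auto simp: level_class_def)
    from padj_level[OF q sV(1) a] show False
    proof
      assume "l q = Suc (l s) \<and> p q = s"
      then have "(l s + 2) mod Suc d = l s mod Suc d" using sV(2) by (simp add: i_def)
      then show False using add_mod_neq[of 2 "Suc d" "l s"] d by simp
    next
      assume "l s = Suc (l q) \<and> p s = q"
      then have "s \<in> children q" using sV(1) level_root by (auto simp: children_def)
      then show False using s by blast
    qed
  qed
  moreover have "\<not> padj p q q" by (simp add: padj_def)
  moreover have "\<not> padj p u w" if "u \<in> level_class d i" "w \<in> level_class d i" for u w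
    using level_class_indep[OF _ that] d by simp
  moreover have "level_class d i \<subseteq> V" by (auto simp: level_class_def)
  ultimately show ?thesis using q padj_sym[of p _ q]
    unfolding indep_dom_def i_def[symmetric] by blast
qed


lemma children_unique:
  assumes d: "2 \<le> d" and z: "z \<in> V" "d \<le> l z" and q: "q \<in> V"
    and height: "\<And>w a. w \<in> V \<Longrightarrow> (p ^^ a) w = q \<Longrightarrow> a \<le> d"
    and card: "card V = k * Suc d"
    and min: "\<And>S. indep_dom p d V S \<Longrightarrow> k \<le> card S"
    and c: "c \<in> children q" "c' \<in> children q"
  shows "c = c'"
proof (rule ccontr)
  assume ne: "c \<noteq> c'"
  let ?i = "Suc (l q) mod Suc d"
  let ?L = "level_class d ?i"
  have i: "?i \<le> d" using mod_less_divisor[of "Suc d"] by (simp add: less_Suc_eq_le)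
  have cL: "card ?L = k"
    using level_class_indep_dom[OF _ _ z] d min i card card_level_classes[of d]
    by (intro sum_eq_const_imp[of d k "\<lambda>i. card (level_class d i)"]) auto
  have fin: "finite ?L" using finite_V by (simp add: level_class_def)
  have sub: "{c, c'} \<subseteq> ?L"
    using c level_parent by (auto simp: children_def level_class_def)
  have "card (insert q (?L - children q)) \<le> Suc (card (?L - children q))"
    by (rule card_insert_le_m1) simp_all
  also have "card (?L - children q) \<le> card (?L - {c, c'})"
    using c fin by (intro card_mono) auto
  also have "card (?L - {c, c'}) = k - 2"
    using card_Diff_subset[OF _ sub] cL ne by simp
  finally have "card (insert q (?L - children q)) \<le> Suc (k - 2)" by simp
  \<comment> \<open>The subtraction is truncated: only with this is \<open>Suc (k - 2)\<close> equal
    to k - 1.\<close>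
  moreover have "2 \<le> k" using card_mono[OF fin sub] ne cL by simp
  moreover have "k \<le> card (insert q (?L - children q))"
    using min[OF replace_children_indep_dom[OF d z q]] height by blast
  ultimately show False by simp
qed


section \<open>Chains of consecutive ancestors\<close>

lemma inj_chain:
  assumes "x \<in> V" "d \<le> l x"
  shows "inj_on (\<lambda>i. (p ^^ i) x) {..d}"
proof (rule inj_onI)
  fix i j assume ij: "i \<in> {..d}" "j \<in> {..d}" "(p ^^ i) x = (p ^^ j) x"
  then have "l x - i = l x - j" using level_ancestor[OF assms(1)] by metis
  then show "i = j" using ij assms(2) by auto
qed

lemma padj_chain:
  assumes "x \<in> V" "d \<le> l x" "i \<le> d" "j \<le> d"
  shows "padj p ((p ^^ i) x) ((p ^^ j) x) \<longleftrightarrow> i = Suc j \<or> j = Suc i"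
proof
  assume "padj p ((p ^^ i) x) ((p ^^ j) x)"
  then have "l x - i = Suc (l x - j) \<or> l x - j = Suc (l x - i)"
    using padj_level[of "(p ^^ i) x" "(p ^^ j) x"] ancestor_in level_ancestor assms(1) by auto
  then show "i = Suc j \<or> j = Suc i" using assms by linarith
next
  assume *: "i = Suc j \<or> j = Suc i"
  have "(p ^^ i) x \<noteq> (p ^^ j) x"
  proof
    assume "(p ^^ i) x = (p ^^ j) x"
    then have "i = j" by (rule inj_onD[OF inj_chain[OF assms(1,2)]]) (use assms in auto)
    then show False using * by simp
  qed
  moreover have "p ((p ^^ i) x) = (p ^^ j) x \<or> p ((p ^^ j) x) = (p ^^ i) x" using * by auto
  ultimately show "padj p ((p ^^ i) x) ((p ^^ j) x)" unfolding padj_def by blast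
qed

definition chain :: "nat \<Rightarrow> 'a \<Rightarrow> 'a set" where
  "chain d x = (\<lambda>i. (p ^^ i) x) ` {..d}"

lemma card_chain: "x \<in> V \<Longrightarrow> d \<le> l x \<Longrightarrow> card (chain d x) = Suc d"
  using card_image[OF inj_chain] by (simp add: chain_def)

lemma chain_subset: "x \<in> V \<Longrightarrow> chain d x \<subseteq> V"
  by (auto simp: chain_def ancestor_in)

section \<open>Pruning a pendant path\<close>

text \<open>With \<open>x\<close> of maximal level, nothing lies more than d levels below the top of
  its chain, so \<open>children_unique\<close> applies throughout that subtree. If
  \<open>d < l x\<close> failed, the root alone would dominate; the strict inequality puts the top
  below the root, so pruning leaves a tree.\<close>

lemma exists_pendant_chain:
  assumes d: "2 \<le> d" and card: "card V = k * Suc d" and k: "2 \<le> k"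
    and min: "\<And>S. indep_dom p d V S \<Longrightarrow> k \<le> card S"
  obtains x where "x \<in> V" "d < l x"
    "\<And>w. w \<in> V \<Longrightarrow> p w \<in> chain d x \<Longrightarrow> w \<in> chain d x"
proof -
  have "Max (l ` V) \<in> l ` V" using finite_V root_in by (intro Max_in) auto
  then obtain x where x: "x \<in> V" "Max (l ` V) = l x" by auto
  have deepest: "l w \<le> l x" if "w \<in> V" for w
    using that x(2) finite_V Max_ge[of "l ` V" "l w"] by simp
  have dx: "d < l x"
  proof (rule ccontr)
    assume "\<not> d < l x"
    then have "indep_dom p d V {r}" using deepest by (intro root_indep_dom) (metis le_trans not_less)
    then show False using min[of "{r}"] k by simp
  qed
  let ?v = "(p ^^ d) x"
  have v: "?v \<in> V" "l ?v = l x - d" using x(1) ancestor_in level_ancestor by auto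
  have height: "a \<le> d" if "w \<in> V" "(p ^^ a) w = ?v" for w a
    using level_ancestor[OF that(1), of a] that(2) v(2) dx deepest[OF that(1)] by simp
  \<comment> \<open>Induction on the depth a below the top: the parent of \<open>w\<close> is
    already known to be a chain vertex, and both \<open>w\<close> and the next chain vertex are
    children of it.\<close>
  have desc: "w = (p ^^ (d - a)) x" if "w \<in> V" "(p ^^ a) w = ?v" for w a
    using that
  proof (induction a arbitrary: w)
    case 0
    then show ?case by simp
  next
    case (Suc a)
    have ad: "Suc a \<le> d" using height[OF Suc.prems] .
    have pw: "p w \<in> V" "(p ^^ a) (p w) = ?v"
      using Suc.prems parent_in' by (auto simp: funpow_swap1)
    have q: "p w = (p ^^ (d - a)) x" using Suc.IH[OF pw] .
    have wr: "w \<noteq> r"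
      using Suc.prems(2) ancestor_root[OF root_in, of "Suc a"] level_root v(2) dx by auto
    have u: "(p ^^ (d - Suc a)) x \<in> V" "(p ^^ (d - Suc a)) x \<noteq> r"
      using x(1) ancestor_in level_ancestor[OF x(1), of "d - Suc a"] level_root dx by auto
    have "p ((p ^^ (d - Suc a)) x) = (p ^^ Suc (d - Suc a)) x" by simp
    also have "\<dots> = p w" using q ad by (simp add: Suc_diff_Suc del: funpow.simps)
    finally have "(p ^^ (d - Suc a)) x \<in> children (p w)" using u by (simp add: children_def)
    moreover have "w \<in> children (p w)" using Suc.prems(1) wr by (simp add: children_def)
    \<comment> \<open>\<open>p w\<close> inherits the height bound from the top, which lies a steps
      above it.\<close>
    moreover have "b \<le> d" if "u \<in> V" "(p ^^ b) u = p w" for u b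
      using height[of u "a + b"] that pw(2) by (simp add: funpow_add)
    ultimately show ?case
      using children_unique[OF d x(1) _ pw(1) _ card min] dx by (metis less_imp_le)
  qed
  have "w \<in> chain d x" if w: "w \<in> V" "p w \<in> chain d x" for w
  proof -
    obtain i where i: "i \<le> d" "p w = (p ^^ i) x" using w(2) by (auto simp: chain_def)
    \<comment> \<open>For i = 0 the exponent is d + 1, which \<open>height\<close> excludes, so
      \<open>desc\<close> holds vacuously there.\<close>
    have "(p ^^ Suc (d - i)) w = (p ^^ (d - i)) (p w)" by (simp only: funpow_Suc_right o_apply)
    also have "\<dots> = (p ^^ (d - i + i)) x" by (simp only: i(2) funpow_add o_apply)
    finally have "(p ^^ Suc (d - i)) w = ?v" using i(1) by simp
    from desc[OF w(1) this] show ?thesis by (auto simp: chain_def)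
  qed
  then show thesis using that x(1) dx by blast
qed

context
  fixes x :: 'a and d :: nat
  assumes x_in: "x \<in> V" and x_level: "d < l x"
    and chain_closed: "\<And>w. w \<in> V \<Longrightarrow> p w \<in> chain d x \<Longrightarrow> w \<in> chain d x"
begin

lemma root_notin_chain: "r \<notin> chain d x"
proof
  assume "r \<in> chain d x"
  then obtain i where "i \<le> d" "r = (p ^^ i) x" by (auto simp: chain_def)
  then show False using level_ancestor[OF x_in, of i] x_level level_root by simp
qed

lemma tree_prune: "end_rooted_tree (V - chain d x) r p l"
proof
  show "finite (V - chain d x)" using finite_V by simp
  show "r \<in> V - chain d x" using root_in root_notin_chain by simp
  show "p v \<in> V - chain d x" if "v \<in> V - chain d x" "v \<noteq> r" for v
    using that chain_closed parent_in by auto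
qed (use parent_root level_root level_parent near_level in auto)

text \<open>Since the chain contains all children of its vertices, the only way off it is upwards
  from its top: a single edge links it to the remainder.\<close>

lemma padj_prune:
  assumes "i \<le> d" "w \<in> V - chain d x"
  shows "padj p ((p ^^ i) x) w \<longleftrightarrow> i = d \<and> w = p ((p ^^ d) x)"
proof
  assume "padj p ((p ^^ i) x) w"
  then have "p ((p ^^ i) x) = w \<or> p w = (p ^^ i) x" by (auto simp: padj_def)
  then show "i = d \<and> w = p ((p ^^ d) x)"
  proof
    assume w: "p ((p ^^ i) x) = w"
    have "\<not> Suc i \<le> d"
    proof
      assume "Suc i \<le> d"
      then have "(p ^^ Suc i) x \<in> chain d x" unfolding chain_def by blast
      then show False using w assms(2) by simp
    qed
    then show ?thesis using w assms(1) by (auto simp: le_less_Suc_eq not_less_eq_eq)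
  next
    assume "p w = (p ^^ i) x"
    then have "p w \<in> chain d x" using assms(1) by (auto simp: chain_def)
    then show ?thesis using chain_closed assms(2) by auto
  qed
next
  assume *: "i = d \<and> w = p ((p ^^ d) x)"
  then have "(p ^^ i) x \<in> V" "(p ^^ i) x \<in> chain d x"
    using ancestor_in[OF x_in] by (auto simp: chain_def)
  then show "padj p ((p ^^ i) x) w" using * padj_parent[of "(p ^^ i) x"] root_notin_chain by auto
qed

lemma parent_top_in: "p ((p ^^ d) x) \<in> V - chain d x"
proof -
  have "l (p ((p ^^ d) x)) = l x - Suc d"
    using level_ancestor[OF x_in, of "Suc d"] by simp
  moreover have "l u > l x - Suc d" if "u \<in> chain d x" for u
    using that level_ancestor[OF x_in] x_level by (fastforce simp: chain_def)
  ultimately show ?thesis using ancestor_in[OF x_in, of "Suc d"] by fastforce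
qed

lemma card_prune: "card V = Suc k * Suc d \<Longrightarrow> card (V - chain d x) = k * Suc d"
  using card_Diff_subset[of "chain d x" V] chain_subset[OF x_in] card_chain[OF x_in] x_level
    finite_V finite_subset by fastforce

text \<open>The bottom \<open>x\<close> is within d of the whole chain, and as
  \<open>1 \<le> d\<close> separates it from the top, it has no neighbour in the remainder.\<close>

lemma indep_dom_prune:
  assumes "1 \<le> d" "indep_dom p d (V - chain d x) S"
  shows "indep_dom p d V (insert x S)"
proof -
  have S: "S \<subseteq> V - chain d x" "\<And>u w. u \<in> S \<Longrightarrow> w \<in> S \<Longrightarrow> \<not> padj p u w"
    "\<And>v. v \<in> V - chain d x \<Longrightarrow> \<exists>s\<in>S. near p d v s"
    using assms(2) by (auto simp: indep_dom_def)
  have "\<not> padj p x s" if "s \<in> S" for s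
    using padj_prune[of 0 s] S(1) that assms(1) by auto
  moreover have "near p d v x" if "v \<in> chain d x" for v
    using that near_funpow[of _ p x v d] near_sym[of p d x v] by (auto simp: chain_def)
  moreover have "\<not> padj p x x" by (simp add: padj_def)
  ultimately show ?thesis
    using S x_in padj_sym[of p _ x] unfolding indep_dom_def by blast
qed

lemma min_prune:
  assumes "1 \<le> d" "\<And>S. indep_dom p d V S \<Longrightarrow> Suc k \<le> card S"
    and S: "indep_dom p d (V - chain d x) S"
  shows "k \<le> card S"
proof -
  have "finite S" using S finite_V finite_subset[of S V] by (auto simp: indep_dom_def)
  moreover have "x \<in> chain d x" unfolding chain_def by (rule image_eqI[of _ _ 0]) auto
  then have "x \<notin> S" using S by (auto simp: indep_dom_def)
  ultimately show ?thesis using assms(2)[OF indep_dom_prune[OF assms(1) S]] by simp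
qed

text \<open>The new column is the chain read downwards from its top, the new base vertex; hence the
  reversed index \<open>d - i\<close>. As the parent of the top is a base vertex, the one connecting
  edge becomes an edge between bases.\<close>

lemma corona_coords_extend:
  assumes co: "corona_coords p d (V - chain d x) B f" and y: "p ((p ^^ d) x) \<in> B"
  shows "corona_coords p d V (insert ((p ^^ d) x) B) (f((p ^^ d) x := \<lambda>i. (p ^^ (d - i)) x))"
proof -
  let ?v = "(p ^^ d) x" and ?V = "V - chain d x"
  let ?f = "f(?v := \<lambda>i. (p ^^ (d - i)) x)"
  have bij: "bij_betw (\<lambda>(b, i). f b i) (B \<times> {..d}) ?V" and f0: "\<And>b. b \<in> B \<Longrightarrow> f b 0 = b"
    and adj: "\<And>b c i j. b \<in> B \<Longrightarrow> c \<in> B \<Longrightarrow> i \<le> d \<Longrightarrow> j \<le> d \<Longrightarrow> padj p (f b i) (f c j) \<longleftrightarrow>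
        b = c \<and> (i = Suc j \<or> j = Suc i) \<or> i = 0 \<and> j = 0 \<and> padj p b c"
    using co unfolding corona_coords_def by blast+
  have fin: "f b i \<in> ?V" if "b \<in> B" "i \<le> d" for b i
    using bij_betw_apply[OF bij, of "(b, i)"] that by simp
  have BV: "b \<in> ?V" if "b \<in> B" for b using fin[OF that, of 0] f0[OF that] by simp
  have vT: "?v \<in> chain d x" by (auto simp: chain_def)
  then have vB: "?v \<notin> B" using BV by blast
  have f_old: "?f b = f b" if "b \<in> B" for b using that vB by auto
  have eq: "(\<lambda>(b, i). ?f b i) ` ({?v} \<times> {..d}) = chain d x"
  proof -
    have "(\<lambda>(b, i). ?f b i) ` ({?v} \<times> {..d}) = (\<lambda>i. (p ^^ (d - i)) x) ` {..d}" by force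
    also have "\<dots> = (\<lambda>i. (p ^^ i) x) ` (\<lambda>i. d - i) ` {..d}" by (simp add: image_image)
    also have "(\<lambda>i. d - i) ` {..d} = {..d}"
      by (auto simp: image_iff) (metis atMost_iff diff_diff_cancel diff_le_self)
    finally show ?thesis by (simp add: chain_def)
  qed
  have "inj_on (\<lambda>(b, i). ?f b i) ({?v} \<times> {..d})"
  proof (rule inj_onI)
    fix s t assume st: "s \<in> {?v} \<times> {..d}" "t \<in> {?v} \<times> {..d}"
      "(\<lambda>(b, i). ?f b i) s = (\<lambda>(b, i). ?f b i) t"
    then obtain i j where ij: "s = (?v, i)" "t = (?v, j)" "i \<le> d" "j \<le> d" by blast
    then have "(p ^^ (d - i)) x = (p ^^ (d - j)) x" using st(3) by simp
    then have "d - i = d - j"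
      using inj_onD[OF inj_chain[OF x_in, of d], of "d - i" "d - j"] x_level by simp
    then show "s = t" using ij by simp
  qed
  then have b1: "bij_betw (\<lambda>(b, i). ?f b i) ({?v} \<times> {..d}) (chain d x)"
    using eq by (simp add: bij_betw_def)
  have b2: "bij_betw (\<lambda>(b, i). ?f b i) (B \<times> {..d}) ?V"
    by (rule iffD1[OF bij_betw_cong bij]) (use f_old in auto)
  have dom: "insert ?v B \<times> {..d} = {?v} \<times> {..d} \<union> B \<times> {..d}" by blast
  have img: "chain d x \<union> ?V = V" using chain_subset[OF x_in] by blast
  have b3: "bij_betw (\<lambda>(b, i). ?f b i) (insert ?v B \<times> {..d}) V"
    using bij_betw_combine[OF b1 b2] unfolding dom img by blast
  have cross: "padj p (?f ?v i) (f c j) \<longleftrightarrow> i = 0 \<and> j = 0 \<and> padj p ?v c"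
    if c: "c \<in> B" "i \<le> d" "j \<le> d" for c i j
  proof -
    \<comment> \<open>The crossing edge starts at the top of the chain, so d - i = d, that is i =
      0.\<close>
    have "padj p (?f ?v i) (f c j) \<longleftrightarrow> i = 0 \<and> f c j = p ?v"
      using padj_prune[of "d - i" "f c j"] fin[OF c(1,3)] c(2) by auto
    also have "f c j = p ?v \<longleftrightarrow> c = p ?v \<and> j = 0"
      using inj_onD[OF bij_betw_imp_inj_on[OF bij], of "(c, j)" "(p ?v, 0)"] c y f0[OF y] by auto
    also have "c = p ?v \<longleftrightarrow> padj p ?v c"
      using padj_prune[of d c] BV[OF c(1)] by auto
    finally show ?thesis by blast
  qed
  have self: "padj p (?f ?v i) (?f ?v j) \<longleftrightarrow> i = Suc j \<or> j = Suc i" if "i \<le> d" "j \<le> d" for i j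
  proof -
    have "padj p (?f ?v i) (?f ?v j) \<longleftrightarrow> d - i = Suc (d - j) \<or> d - j = Suc (d - i)"
      using padj_chain[OF x_in, of d "d - i" "d - j"] x_level by simp
    also have "\<dots> \<longleftrightarrow> i = Suc j \<or> j = Suc i" using that by linarith
    finally show ?thesis .
  qed
  have psym: "padj p u w \<longleftrightarrow> padj p w u" for u w by (auto simp: padj_def)
  have irr: "\<not> padj p u u" for u by (simp add: padj_def)
  have "padj p (?f b i) (?f c j) \<longleftrightarrow>
        b = c \<and> (i = Suc j \<or> j = Suc i) \<or> i = 0 \<and> j = 0 \<and> padj p b c"
    if "b \<in> insert ?v B" "c \<in> insert ?v B" "i \<le> d" "j \<le> d" for b c i j
  proof (cases "b = ?v")
    case b: True
    show ?thesis
    proof (cases "c = ?v")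
      case True
      then show ?thesis unfolding b using self[OF that(3,4)] irr by blast
    next
      case False
      then have "c \<in> B" using that by blast
      then show ?thesis unfolding b f_old[OF \<open>c \<in> B\<close>] using cross[of c i j] that False by blast
    qed
  next
    case False
    then have b: "b \<in> B" using that by blast
    show ?thesis
    proof (cases "c = ?v")
      case True
      then show ?thesis unfolding True f_old[OF b]
        using cross[of b j i] that False b psym[of "f b i"] psym[of b] by blast
    next
      case False
      then have c: "c \<in> B" using that by blast
      show ?thesis unfolding f_old[OF b] f_old[OF c] using adj[OF b c that(3,4)] .
    qed
  qed
  moreover have "?f b 0 = b" if "b \<in> insert ?v B" for b
    using that f0 f_old by auto
  ultimately show ?thesis using b3 unfolding corona_coords_def by blast
qed

end

end


section \<open>Extremal trees are coronas\<close>

lemma corona_coords_column_near: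
  assumes "corona_coords p d V B f" "b \<in> B" "i \<le> j" "j \<le> d"
  shows "near p (j - i) (f b i) (f b j)"
proof (rule near_chain[OF _ assms(3,4)])
  fix i assume "i < d"
  then show "padj p (f b i) (f b (Suc i))"
    using assms(1,2) unfolding corona_coords_def by (metis Suc_leI less_imp_le)
qed

lemma corona_coords_card:
  assumes "corona_coords p d V B f"
  shows "card V = card B * Suc d"
  using bij_betw_same_card[of "\<lambda>(b, i). f b i" "B \<times> {..d}" V] assms
  by (simp add: corona_coords_def card_cartesian_product)

lemma corona_coords_cases:
  assumes "corona_coords p d V B f" "w \<in> V"
  obtains b i where "b \<in> B" "i \<le> d" "w = f b i"
proof -
  have "w \<in> (\<lambda>(b, i). f b i) ` (B \<times> {..d})"
    using assms by (simp add: corona_coords_def bij_betw_def)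
  then show thesis using that by auto
qed

lemma corona_coords_in:
  assumes "corona_coords p d V B f" "b \<in> B" "i \<le> d"
  shows "f b i \<in> V"
  using bij_betw_apply[of "\<lambda>(b, i). f b i" "B \<times> {..d}" V "(b, i)"] assms
  by (simp add: corona_coords_def)

lemma corona_coords_base:
  assumes "corona_coords p d V B f" "b \<in> B"
  shows "f b 0 = b"
  using assms by (simp add: corona_coords_def)

lemma corona_coords_eq_iff:
  assumes "corona_coords p d V B f" "b \<in> B" "c \<in> B" "i \<le> d" "j \<le> d"
  shows "f b i = f c j \<longleftrightarrow> b = c \<and> i = j"
proof
  have "inj_on (\<lambda>(b, i). f b i) (B \<times> {..d})"
    using assms(1) by (simp add: corona_coords_def bij_betw_def)
  moreover assume "f b i = f c j"
  ultimately show "b = c \<and> i = j"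
    using inj_onD[of "\<lambda>(b, i). f b i" "B \<times> {..d}" "(b, i)" "(c, j)"] assms by simp
qed simp

lemma corona_coords_padj:
  assumes "corona_coords p d V B f" "b \<in> B" "c \<in> B" "i \<le> d" "j \<le> d"
  shows "padj p (f b i) (f c j) \<longleftrightarrow>
        b = c \<and> (i = Suc j \<or> j = Suc i) \<or> i = 0 \<and> j = 0 \<and> padj p b c"
  using assms unfolding corona_coords_def by blast

context end_rooted_tree begin

text \<open>A degenerate corona over one base vertex, here the lower end: this column is read
  upwards, unlike those added by pruning in reverse. It serves for the remainder in the case k = 2,
  whose far end is the root.\<close>

lemma chain_corona_coords:
  assumes "x \<in> V" "d \<le> l x"
  shows "corona_coords p d (chain d x) {x} (\<lambda>_ i. (p ^^ i) x)"
proof -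
  have "bij_betw (\<lambda>(b, i). (p ^^ i) x) ({x} \<times> {..d}) (chain d x)"
  proof (rule bij_betw_imageI)
    show "inj_on (\<lambda>(b, i). (p ^^ i) x) ({x} \<times> {..d})"
    proof (rule inj_onI)
      fix s t assume st: "s \<in> {x} \<times> {..d}" "t \<in> {x} \<times> {..d}"
        "(\<lambda>(b, i). (p ^^ i) x) s = (\<lambda>(b, i). (p ^^ i) x) t"
      then obtain i j where ij: "s = (x, i)" "t = (x, j)" "i \<le> d" "j \<le> d" by blast
      then have "(p ^^ i) x = (p ^^ j) x" using st(3) by simp
      then have "i = j" by (rule inj_onD[OF inj_chain[OF assms]]) (use ij in auto)
      then show "s = t" using ij by simp
    qed
  qed (auto simp: chain_def)
  moreover have "\<not> padj p x x" by (simp add: padj_def)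
  ultimately show ?thesis
    using padj_chain[OF assms] unfolding corona_coords_def by simp
qed

context
  fixes x :: 'a and d :: nat
  assumes d: "2 \<le> d" and x_in: "x \<in> V" and x_level: "d < l x"
    and chain_closed: "\<And>w. w \<in> V \<Longrightarrow> p w \<in> chain d x \<Longrightarrow> w \<in> chain d x"
begin

lemma near_top_chain: "w \<in> chain d x \<Longrightarrow> near p d ((p ^^ d) x) w"
proof -
  assume "w \<in> chain d x"
  then obtain i where i: "i \<le> d" "w = (p ^^ i) x" by (auto simp: chain_def)
  have "(p ^^ (d - i)) w = (p ^^ (d - i + i)) x" by (simp only: i(2) funpow_add o_apply)
  then have "(p ^^ (d - i)) w = (p ^^ d) x" using i(1) by simp
  then show ?thesis using near_funpow[of "d - i" p w] near_sym[of p d w] by simp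
qed

lemma near_top_outside:
  "near p m (p ((p ^^ d) x)) w \<Longrightarrow> Suc m \<le> n \<Longrightarrow> near p n ((p ^^ d) x) w"
  using near_trans[OF near_funpow[of 1 p "(p ^^ d) x" "p ((p ^^ d) x)" 1], of m w]
    near_mono[of p "Suc m" _ w n] by simp

text \<open>If j > 0, column a needs no member of its own: \<open>b\<close> is within d of all its
  vertices but the last, and that one is at distance at most 1 + (d - j) \<le> d from the top of the
  chain. Independence survives because the only neighbour of the top outside the chain is in column
  a, where nothing was chosen.\<close>

lemma attached_at_base:
  assumes co: "corona_coords p d (V - chain d x) B f"
    and nbr: "\<And>a. a \<in> B \<Longrightarrow> \<exists>b\<in>B. padj p a b"
    and a: "a \<in> B" and j: "j \<le> d" and top: "p ((p ^^ d) x) = f a j"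
    and min: "\<And>S. indep_dom p d V S \<Longrightarrow> Suc (card B) \<le> card S"
  shows "j = 0"
proof (rule ccontr)
  assume j0: "j \<noteq> 0"
  let ?v = "(p ^^ d) x"
  obtain b where b: "b \<in> B" "padj p a b" using nbr a by blast
  have ab: "a \<noteq> b" using b(2) by (auto simp: padj_def)
  let ?S = "insert ?v (insert b ((\<lambda>c. f c d) ` (B - {a, b})))"
  note eq_iff = corona_coords_eq_iff[OF co] and adj = corona_coords_padj[OF co]
  have BV: "c \<in> V - chain d x" if "c \<in> B" for c
    using corona_coords_in[OF co that, of 0] corona_coords_base[OF co that] by simp
  have finB: "finite B" using BV finite_V finite_subset[of B V] by blast
  have top_adj: "padj p ?v w \<longleftrightarrow> w = f a j" if "w \<in> V - chain d x" for w
    using padj_prune[OF x_in x_level chain_closed, of d w] that top by simp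
  have S1: "\<not> padj p ?v s" if s: "s \<in> insert b ((\<lambda>c. f c d) ` (B - {a, b}))" for s
  proof (cases "s = b")
    case True
    have "f b 0 \<noteq> f a j" using eq_iff[OF b(1) a, of 0 j] j j0 by simp
    then show ?thesis using top_adj BV[OF b(1)] True corona_coords_base[OF co b(1)] by simp
  next
    case False
    then obtain c where c: "c \<in> B" "c \<noteq> a" "s = f c d" using s by blast
    then have "s \<noteq> f a j" using eq_iff[OF c(1) a, of d j] j by simp
    then show ?thesis using top_adj corona_coords_in[OF co c(1), of d] c(3) by simp
  qed
  have S2: "\<not> padj p b (f c d)" if "c \<in> B - {a, b}" for c
    using adj[OF b(1), of c 0 d] corona_coords_base[OF co b(1)] that d by auto
  have S3: "\<not> padj p (f c d) (f c' d)" if "c \<in> B" "c' \<in> B" for c c'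
    using adj[OF that, of d d] d by simp
  have irr: "\<not> padj p u u" for u by (simp add: padj_def)
  have indep: "\<not> padj p u w" if "u \<in> ?S" "w \<in> ?S" for u w
  proof -
    have psym: "padj p t t' \<longleftrightarrow> padj p t' t" for t t' by (auto simp: padj_def)
    consider "u = ?v" "w = ?v" | "u = ?v" "w \<noteq> ?v" | "u \<noteq> ?v" "w = ?v" |
      "u \<noteq> ?v" "w \<noteq> ?v" by blast
    then show ?thesis
    proof cases
      case 1
      then show ?thesis using irr by simp
    next
      case 2
      then have "w \<in> insert b ((\<lambda>c. f c d) ` (B - {a, b}))" using that(2) by blast
      then show ?thesis using S1 2(1) by blast
    next
      case 3
      then have "u \<in> insert b ((\<lambda>c. f c d) ` (B - {a, b}))" using that(1) by blast
      then show ?thesis using S1 3(2) psym by blast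
    next
      case 4
      then have u: "u = b \<or> (\<exists>c\<in>B - {a, b}. u = f c d)"
        and w: "w = b \<or> (\<exists>c\<in>B - {a, b}. w = f c d)" using that by blast+
      then show ?thesis using S2 S3 irr psym by blast
    qed
  qed
  have dom: "\<exists>s\<in>?S. near p d w s" if w: "w \<in> V" for w
  proof (cases "w \<in> chain d x")
    case True
    then have "near p d w ?v" using near_sym[OF near_top_chain] by simp
    then show ?thesis by (rule bexI) simp
  next
    case False
    then obtain c i where c: "c \<in> B" "i \<le> d" "w = f c i"
      using corona_coords_cases[OF co] w by (metis DiffI)
    consider "c \<in> B - {a, b}" | "c = b" | "c = a" "i = d" | "c = a" "i < d"
      using c by fastforce
    then show ?thesis
    proof cases
      case 1
      then have "near p d w (f c d)"
        using corona_coords_column_near[OF co c(1,2)] near_mono[of p "d - i" w] c(3) by simp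
      then show ?thesis by (rule bexI) (use 1 in simp)
    next
      case 2
      have "near p i (f b 0) w" using corona_coords_column_near[OF co b(1), of 0 i] c 2 by simp
      then have "near p d w b"
        using near_sym[OF near_mono[of p i "f b 0" w d]] c(2) corona_coords_base[OF co b(1)] by simp
      then show ?thesis by (rule bexI) simp
    next
      case 3
      have "near p (d - j) (f a j) w" using corona_coords_column_near[OF co a j] c 3 by simp
      then have "near p d ?v w" using near_top_outside[of "d - j" w d] j j0 d top by simp
      then show ?thesis by (intro bexI[where x = ?v] near_sym[of p d ?v w]) simp_all
    next
      case 4
      have "near p i (f a 0) w" using corona_coords_column_near[OF co a, of 0 i] c 4 by simp
      then have "near p (Suc i) w b"
        using near_Suc[OF near_sym b(2)] corona_coords_base[OF co a] by simp
      then have "near p d w b" using near_mono[of p "Suc i" w b d] 4 by simp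
      then show ?thesis by (rule bexI) simp
    qed
  qed
  have "?S \<subseteq> V"
    using ancestor_in[OF x_in, of d] BV[OF b(1)] corona_coords_in[OF co, of _ d] by blast
  then have "indep_dom p d V ?S" using indep dom unfolding indep_dom_def by blast
  then have "Suc (card B) \<le> card ?S" by (rule min)
  also have "card ?S \<le> Suc (Suc (card ((\<lambda>c. f c d) ` (B - {a, b}))))"
    using finB by (simp add: card_insert_if)
  also have "card ((\<lambda>c. f c d) ` (B - {a, b})) \<le> card (B - {a, b})"
    using finB by (intro card_image_le) simp
  also have "card (B - {a, b}) = card B - 2"
    using card_Diff_subset[of "{a, b}" B] a b(1) ab by simp
  \<comment> \<open>With two columns or more, \<open>Suc (Suc (card B - 2))\<close> is
    \<open>card B\<close>, one too few; truncation leaves only this escape.\<close>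
  finally have "card B < 2" by simp
  moreover have "2 \<le> card B" using card_mono[OF finB, of "{a, b}"] a b(1) ab by simp
  ultimately show False by simp
qed

text \<open>Let y be the parent of the top. Were all of the remainder within d - 1 of y, the top
  alone would dominate the tree. So some vertex is at distance at least d from y, which forces a
  vertex z of level at least d, and the chain of z already exhausts the remainder. An inner vertex
  of this path is within d - 1 of all of it, so y is one of its ends; the root end is ruled out by
  \<open>near_level\<close>.\<close>

lemma prune_is_chain:
  assumes card: "card (V - chain d x) = Suc d"
    and min: "\<And>S. indep_dom p d V S \<Longrightarrow> 2 \<le> card S"
  shows "d \<le> l (p ((p ^^ d) x)) \<and> V - chain d x = chain d (p ((p ^^ d) x))"
proof -
  let ?v = "(p ^^ d) x" and ?y = "p ((p ^^ d) x)" and ?V = "V - chain d x"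
  interpret P: end_rooted_tree ?V r p l
    by (rule tree_prune[OF x_in x_level chain_closed])
  have y: "?y \<in> ?V" by (rule parent_top_in[OF x_in x_level chain_closed])
  have far: "\<exists>w\<in>?V. \<not> near p (d - 1) ?y w"
  proof (rule ccontr)
    assume all: "\<not> (\<exists>w\<in>?V. \<not> near p (d - 1) ?y w)"
    have top_near: "near p d ?v w" if "w \<in> V" for w
    proof (cases "w \<in> chain d x")
      case False
      then have "near p (d - 1) ?y w" using all that by blast
      then show ?thesis by (rule near_top_outside) (use d in simp)
    qed (rule near_top_chain)
    have "near p d w ?v" if "w \<in> V" for w using near_sym[OF top_near[OF that]] .
    then have "indep_dom p d V {?v}"
      using ancestor_in[OF x_in, of d] by (simp add: indep_dom_def padj_def)
    then have "2 \<le> card {?v}" by (rule min)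
    then show False by simp
  qed
  then obtain w where w: "w \<in> ?V" "\<not> near p (d - 1) ?y w" by blast
  \<comment> \<open>\<open>near_level\<close> converts a large distance between \<open>?y\<close>
    and \<open>w\<close> into a large level of one of them.\<close>
  then have "\<not> max (l ?y) (l w) \<le> d - 1"
    using near_mono[OF P.near_level[OF y w(1)], of "d - 1"] by blast
  then obtain z where z: "z \<in> ?V" "d \<le> l z" using w(1) y by (cases "l w \<le> d - 1") auto
  have Vz: "?V = P.chain d z"
    using card_subset_eq[OF P.finite_V P.chain_subset[OF z(1)]] P.card_chain[OF z] card by simp
  have mem: "\<exists>i\<le>d. t = (p ^^ i) z" if "t \<in> ?V" for t
  proof -
    have "t \<in> P.chain d z" using that by (simp only: Vz)
    then show ?thesis by (auto simp: P.chain_def)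
  qed
  obtain i where i: "i \<le> d" "?y = (p ^^ i) z" using mem[OF y] by blast
  have "i = 0 \<or> i = d"
  proof (rule ccontr)
    assume ni: "\<not> (i = 0 \<or> i = d)"
    obtain k where k: "k \<le> d" "w = (p ^^ k) z" using mem[OF w(1)] by blast
    have ch: "near p (n - m) ((p ^^ m) z) ((p ^^ n) z)" if "m \<le> n" for m n
    proof -
      have "(p ^^ (n - m)) ((p ^^ m) z) = (p ^^ (n - m + m)) z" by (simp only: funpow_add o_apply)
      then have "(p ^^ (n - m)) ((p ^^ m) z) = (p ^^ n) z" using that by simp
      then show ?thesis by (rule near_funpow) simp
    qed
    have "near p (d - 1) ?y w"
    proof (cases "i \<le> k")
      case True
      moreover have "k - i \<le> d - 1" using k(1) ni by linarith
      ultimately show ?thesis using ch[of i k] near_mono[of p "k - i" ?y w "d - 1"] i k by simp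
    next
      case False
      moreover have "i - k \<le> d - 1" using i(1) ni by linarith
      ultimately show ?thesis
        using near_sym[OF ch[of k i]] near_mono[of p "i - k" ?y w "d - 1"] i k by simp
    qed
    then show False using w(2) by simp
  qed
  \<comment> \<open>Otherwise \<open>?y\<close> is the root, with \<open>z\<close> on level d and
    \<open>x\<close> on level d + 1 in different branches. Their distance would be 2d + 1, but
    \<open>near_level\<close> allows only d + 1.\<close>
  moreover have "i \<noteq> d"
  proof
    assume "i = d"
    obtain i' where "i' \<le> d" "r = (p ^^ i') z"
      using mem[OF P.root_in] by blast
    then have lz: "l z = d" using P.level_ancestor[OF z(1), of i'] level_root z(2) by simp
    then have yr: "?y = r" using P.ancestor_root[OF z(1)] i \<open>i = d\<close> by simp
    have "l ?y = l x - Suc d" using level_ancestor[OF x_in, of "Suc d"] by simp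
    then have lx: "l x = Suc d" using yr level_root x_level by simp
    obtain a b where ab: "a + b \<le> Suc d" "(p ^^ a) z = (p ^^ b) x"
      using near_level[of z x] z(1) x_in lx lz by (auto simp: near_def)
    show False
    proof (cases "b \<le> d")
      case True
      then have "(p ^^ b) x \<in> chain d x" by (auto simp: chain_def)
      then show False using ab(2) P.ancestor_in[OF z(1), of a] by simp
    next
      case False
      then have "a = 0" "b = Suc d" using ab(1) by auto
      then have "z = r" using ab(2) yr by simp
      then show False using z(2) level_root d by simp
    qed
  qed
  ultimately have "?y = z" using i(2) by simp
  then show ?thesis using z(2) Vz by (simp add: P.chain_def chain_def)
qed

end
end

text \<open>The second conjunct strengthens the induction, providing the base neighbour that
  \<open>attached_at_base\<close> asks for. It fails for a single column, which is why the claim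
  starts at k = 2.\<close>

lemma extremal_tree_corona_coords:
  assumes d: "2 \<le> d"
  shows "end_rooted_tree V r p l \<Longrightarrow> card V = k * Suc d \<Longrightarrow>
    (\<And>S. indep_dom p d V S \<Longrightarrow> k \<le> card S) \<Longrightarrow> 2 \<le> k \<Longrightarrow>
    \<exists>B f. corona_coords p d V B f \<and> (\<forall>a\<in>B. \<exists>b\<in>B. padj p a b)"
proof (induction k arbitrary: V)
  case 0
  then show ?case by simp
next
  case (Suc k)
  interpret end_rooted_tree V r p l by fact
  obtain x where x: "x \<in> V" "d < l x"
    and closed: "\<And>w. w \<in> V \<Longrightarrow> p w \<in> chain d x \<Longrightarrow> w \<in> chain d x"
    using exists_pendant_chain[OF d Suc.prems(2,4,3)] by metis
  let ?v = "(p ^^ d) x" and ?y = "p ((p ^^ d) x)" and ?V = "V - chain d x"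
  note prune = x closed
  have tree: "end_rooted_tree ?V r p l" by (rule tree_prune[OF prune])
  have card: "card ?V = k * Suc d" by (rule card_prune[OF prune Suc.prems(2)])
  have min: "k \<le> card S" if "indep_dom p d ?V S" for S
    using min_prune[OF prune _ Suc.prems(3) that] d by simp
  have y: "?y \<in> ?V" by (rule parent_top_in[OF prune])
  \<comment> \<open>The exception \<open>a = ?y\<close> admits the one-column remainder; it
    disappears once \<open>?v\<close>, a neighbour of \<open>?y\<close>, joins the base.\<close>
  have "\<exists>B f. corona_coords p d ?V B f \<and> ?y \<in> B \<and> (\<forall>a\<in>B. a = ?y \<or> (\<exists>b\<in>B. padj p a b))"
  proof (cases "k = 1")
    case True
    then have "d \<le> l ?y" "?V = chain d ?y"
      using prune_is_chain[OF d prune] card Suc.prems(3) by (simp_all add: numeral_2_eq_2)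
    then show ?thesis using chain_corona_coords[of ?y d] y by (metis DiffD1 singleton_iff)
  next
    case False
    then obtain B f where co: "corona_coords p d ?V B f" "\<And>a. a \<in> B \<Longrightarrow> \<exists>b\<in>B. padj p a b"
      using Suc.IH[OF tree card min] Suc.prems(4) by auto
    have "k * Suc d = card B * Suc d" using corona_coords_card[OF co(1)] card by argo
    then have "card B = k" by (simp only: mult_cancel2) simp
    moreover obtain a j where a: "a \<in> B" "j \<le> d" "?y = f a j"
      using corona_coords_cases[OF co(1) y] .
    ultimately have "j = 0" using attached_at_base[OF d prune co a] Suc.prems(3) by simp
    then have "?y \<in> B" using a corona_coords_base[OF co(1) a(1)] by simp
    then show ?thesis using co by blast
  qed
  then obtain B f where co: "corona_coords p d ?V B f" "?y \<in> B"
    "\<forall>a\<in>B. a = ?y \<or> (\<exists>b\<in>B. padj p a b)" by blast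
  have "padj p ?v ?y" using padj_prune[OF prune, of d ?y] y by simp
  then have vy: "padj p ?v ?y" "padj p ?y ?v" using padj_sym[of p ?v ?y] by simp_all
  have "\<exists>b\<in>insert ?v B. padj p a b" if a: "a \<in> insert ?v B" for a
  proof -
    consider "a = ?v" | "a = ?y" | "a \<in> B" "a \<noteq> ?y" using a by blast
    then show ?thesis using vy co(2,3) by cases (meson insertI1 insertI2)+
  qed
  then show ?case using corona_coords_extend[OF prune co(1,2)] by blast
qed


section \<open>Undirected trees as rooted trees\<close>

lemma undirected_treeD:
  assumes "undirected_tree T"
  shows "pair_graph T" "pverts T \<noteq> {}"
    "\<And>u v. u \<in> pverts T \<Longrightarrow> v \<in> pverts T \<Longrightarrow> (u, v) \<in> rtrancl_on (pverts T) (parcs T)"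
proof -
  show pg: "pair_graph T" using assms by (simp add: undirected_tree_def)
  interpret pair_graph T by fact
  have con: "strongly_connected (mk_symmetric (with_proj T))"
    using assms by (simp add: undirected_tree_def connected_def)
  then show "pverts T \<noteq> {}" by (simp add: strongly_connected_def)
  fix u v assume "u \<in> pverts T" "v \<in> pverts T"
  then have "u \<rightarrow>\<^sup>*\<^bsub>mk_symmetric (with_proj T)\<^esub> v"
    using con by (simp add: strongly_connected_def)
  then have "u \<rightarrow>\<^sup>*\<^bsub>with_proj T\<^esub> v" using reachable_mk_symmetric_eq[OF sym_arcs] by simp
  then show "(u, v) \<in> rtrancl_on (pverts T) (parcs T)" by (simp add: reachable_def)
qed

text \<open>This is how acyclicity enters: a simple path in \<open>H\<close> from \<open>u\<close>
  to \<open>w\<close>, closed by the arc back, would be a cycle. Taking the parent edges of a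
  spanning tree for \<open>H\<close> shows that there are no other arcs.\<close>

lemma undirected_tree_no_detour:
  assumes T: "undirected_tree T" and H: "H \<subseteq> parcs T" and uw: "(u, w) \<in> H\<^sup>*"
    and arc: "(u, w) \<in> parcs T"
  shows "(u, w) \<in> H"
proof (rule ccontr)
  assume nH: "(u, w) \<notin> H"
  interpret pair_graph T using undirected_treeD(1)[OF T] .
  let ?H = "\<lparr> pverts = pverts T, parcs = H \<rparr>"
  interpret H: pair_wf_digraph ?H
    using H in_arcsD1 in_arcsD2 by unfold_locales auto
  have V: "u \<in> pverts T" "w \<in> pverts T" using in_arcsD1[OF arc] in_arcsD2[OF arc] .
  have ne: "u \<noteq> w" using no_loops'[OF arc] .
  have sub: "subgraph (with_proj ?H) (with_proj T)"
    using H by (auto simp: subgraph_def compatible_def wf_digraph_wp_iff) unfold_locales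
  have "(u, w) \<in> rtrancl_on (pverts T) H"
    by (rule rtrancl_consistent_rtrancl_on[OF uw V]) (use H in_arcsD2 in auto)
  then have "u \<rightarrow>\<^sup>*\<^bsub>with_proj ?H\<^esub> w" by (simp add: reachable_def)
  then obtain q where q: "H.apath u q w" using H.reachable_apath by auto
  then have qT: "awalk u q w" "distinct (pawalk_verts u q)"
    using subgraph_awalk_imp_awalk[OF _ sub, of u q w] by (auto simp: H.apath_def)
  have q1: "q \<noteq> []" using q ne by (auto simp: H.apath_Nil_iff)
  \<comment> \<open>A single arc would be (u, w) itself, which is not in \<open>H\<close>; so the
    closed walk has length at least 3 and is not just an edge run back and forth.\<close>
  have q2: "q \<noteq> [e]" for e
    using q nH by (auto simp: H.apath_def H.awalk_simps)
  then have len: "2 \<le> length q" using q1 by (cases q rule: remdups_adj.cases) auto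
  have wu: "awalk w [(w, u)] u" using arcs_symmetric[OF arc] V by (simp add: awalk_simps)
  have "awalk u (q @ [(w, u)]) u" by (rule awalk_appendI[OF qT(1) wu])
  moreover have "pawalk_verts u (q @ [(w, u)]) = pawalk_verts u q @ [u]"
    using awalk_verts_append[OF \<open>awalk u (q @ [(w, u)]) u\<close>] qT(1) by simp
  moreover obtain vs where "pawalk_verts u q = u # vs"
    using qT(1) q1 by (cases q) (auto simp: awalk_simps)
  ultimately have "cycle (q @ [(w, u)])"
    unfolding cycle_def using qT(2) by (auto intro!: exI[of _ u])
  moreover have "3 \<le> length (q @ [(w, u)])" using len by simp
  ultimately show False using T unfolding undirected_tree_def by blast
qed

lemma sym_relpow: "sym E \<Longrightarrow> (x, y) \<in> E ^^ n \<Longrightarrow> (y, x) \<in> E ^^ n"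
proof (induction n arbitrary: y)
  case (Suc n)
  then obtain z where "(x, z) \<in> E ^^ n" "(z, y) \<in> E" by auto
  then show ?case using Suc relpow_Suc_I2[of y z E x n] by (auto dest: symD)
qed simp

context rooted_tree begin

text \<open>Applying \<open>p\<close> at the root makes no step in the graph, so a iterations yield
  a walk of length at most a. Hence the right-hand side bounds the length instead of fixing
  it.\<close>

lemma near_iff_walk:
  assumes E: "\<And>u w. (u, w) \<in> E \<longleftrightarrow> u \<in> V \<and> w \<in> V \<and> padj p u w"
    and uw: "u \<in> V" "w \<in> V"
  shows "near p m u w \<longleftrightarrow> (\<exists>i\<le>m. (u, w) \<in> E ^^ i)"
proof
  have symE: "sym E" using E padj_sym by (auto intro!: symI)
  have up: "\<exists>i\<le>a. (v, (p ^^ a) v) \<in> E ^^ i" if v: "v \<in> V" for v a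
  proof (induction a)
    case 0
    then show ?case by simp
  next
    case (Suc a)
    then obtain i where i: "i \<le> a" "(v, (p ^^ a) v) \<in> E ^^ i" by blast
    show ?case
    proof (cases "(p ^^ a) v = r")
      case True
      then have "(p ^^ Suc a) v = (p ^^ a) v" using parent_root by simp
      then show ?thesis using i le_SucI by metis
    next
      case False
      then have "((p ^^ a) v, (p ^^ Suc a) v) \<in> E"
        using E padj_parent ancestor_in[OF v] parent_in' by simp
      then have "(v, (p ^^ Suc a) v) \<in> E ^^ Suc i" using i(2) by (rule relpow_Suc_I[rotated])
      then show ?thesis using i(1) by (metis Suc_le_mono)
    qed
  qed
  assume "near p m u w"
  then obtain a b where ab: "a + b \<le> m" "(p ^^ a) u = (p ^^ b) w" by (auto simp: near_def)
  obtain i where i: "i \<le> a" "(u, (p ^^ a) u) \<in> E ^^ i" using up uw by blast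
  obtain j where j: "j \<le> b" "(w, (p ^^ b) w) \<in> E ^^ j" using up uw by blast
  have "((p ^^ a) u, w) \<in> E ^^ j" using sym_relpow[OF symE j(2)] ab(2) by simp
  then have "(u, w) \<in> E ^^ (i + j)" using i(2) unfolding relpow_add by blast
  then show "\<exists>i\<le>m. (u, w) \<in> E ^^ i" using i(1) j(1) ab(1) by (intro exI[of _ "i + j"]) simp
next
  assume "\<exists>i\<le>m. (u, w) \<in> E ^^ i"
  then obtain i where i: "i \<le> m" "(u, w) \<in> E ^^ i" by blast
  from i(2) have "near p i u w"
  proof (induction i arbitrary: w)
    case (Suc i)
    then obtain v where "(u, v) \<in> E ^^ i" "(v, w) \<in> E" by auto
    then show ?case using Suc.IH near_Suc E by metis
  qed simp
  then show "near p m u w" using i(1) by (rule near_mono)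
qed

text \<open>Put D = \<open>l x\<close>. Climbing a steps from \<open>u\<close> leads to the vertex b
  steps above \<open>x\<close>, and a + b \<le> D makes this branch no longer than the way D - b on
  to the root. For two vertices, let \<open>w\<close> be the one whose branch starts nearer the
  root. From the start of the branch of \<open>u\<close>, going along the path and then out to
  \<open>w\<close> costs no more than going to the root, so the distance is at most
  \<open>l u\<close>.\<close>

lemma end_rooted_treeI:
  assumes x: "x \<in> V" and far: "\<And>u. u \<in> V \<Longrightarrow> near p (l x) u x"
  shows "end_rooted_tree V r p l"
proof unfold_locales
  define D where "D = l x"
  have branch: "\<exists>a b. a \<le> l u \<and> b \<le> D \<and> a \<le> D - b \<and> l u = a + (D - b) \<and> (p ^^ a) u = (p ^^ b) x"
    if u: "u \<in> V" for u
  proof -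
    obtain a b where ab: "a + b \<le> D" "(p ^^ a) u = (p ^^ b) x"
      using far[OF u] by (auto simp: near_def D_def)
    have "l u - a = D - b"
      using level_ancestor[OF u, of a] level_ancestor[OF x, of b] ab(2) by (simp add: D_def)
    then show ?thesis using ab by (intro exI[of _ a] exI[of _ b]) auto
  qed
  have key: "near p (l u) u w"
    if "b \<le> b'" "b' \<le> D" "a' \<le> D - b'" "l u = a + (D - b)"
      "(p ^^ a) u = (p ^^ b) x" "(p ^^ a') w = (p ^^ b') x" for u w a b a' b'
  proof -
    have "(p ^^ (b' - b + a)) u = (p ^^ (b' - b)) ((p ^^ b) x)"
      by (simp only: funpow_add o_apply that(5))
    also have "\<dots> = (p ^^ (b' - b + b)) x" by (simp only: funpow_add o_apply)
    also have "\<dots> = (p ^^ a') w" using that by simp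
    finally show ?thesis unfolding near_def
      using that(1-4) by (intro exI[of _ "b' - b + a"] exI[of _ a']) simp
  qed
  fix u w assume "u \<in> V" "w \<in> V"
  obtain a b where u: "b \<le> D" "a \<le> D - b" "l u = a + (D - b)" "(p ^^ a) u = (p ^^ b) x"
    using branch[OF \<open>u \<in> V\<close>] by blast
  obtain a' b' where w: "b' \<le> D" "a' \<le> D - b'" "l w = a' + (D - b')" "(p ^^ a') w = (p ^^ b') x"
    using branch[OF \<open>w \<in> V\<close>] by blast
  show "near p (max (l u) (l w)) u w"
  proof (cases "b \<le> b'")
    case True
    from key[OF this w(1,2) u(3,4) w(4)] show ?thesis by (rule near_mono) simp
  next
    case False
    then have "b' \<le> b" by simp
    from near_sym[OF key[OF this u(1,2) w(3,4) u(4)]] show ?thesis by (rule near_mono) simp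
  qed
qed

end

text \<open>A breadth-first tree from an end \<open>r\<close> of a longest path. Its edges connect
  all vertices, so \<open>undirected_tree_no_detour\<close> makes them the only arcs; the other end
  \<open>x\<close> meets the condition of \<open>end_rooted_treeI\<close>, being at maximal distance
  from \<open>r\<close>.\<close>

lemma undirected_tree_rooted:
  assumes T: "undirected_tree T"
  obtains r p l where "end_rooted_tree (pverts T) r p l"
    "\<And>u w. (u, w) \<in> parcs T \<longleftrightarrow> u \<in> pverts T \<and> w \<in> pverts T \<and> padj p u w"
proof -
  interpret pair_graph T using undirected_treeD(1)[OF T] .
  let ?V = "pverts T" and ?E = "parcs T"
  define dst where "dst u w = (LEAST m. (u, w) \<in> ?E ^^ m)" for u w
  have walk: "(u, w) \<in> ?E ^^ dst u w" if "u \<in> ?V" "w \<in> ?V" for u w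
  proof -
    have "(u, w) \<in> ?E\<^sup>*" using undirected_treeD(3)[OF T that] by (rule rtrancl_on_rtranclI)
    then obtain m where "(u, w) \<in> ?E ^^ m" using rtrancl_imp_relpow by blast
    then show ?thesis unfolding dst_def by (rule LeastI)
  qed
  have dst_le: "dst u w \<le> m" if "(u, w) \<in> ?E ^^ m" for u w m
    unfolding dst_def using that by (rule Least_le)
  have finV: "finite ?V" using pair_finite_verts .
  let ?D = "(\<lambda>(u, w). dst u w) ` (?V \<times> ?V)"
  have "Max ?D \<in> ?D" using finV undirected_treeD(2)[OF T] by (intro Max_in) auto
  then obtain r x where rx: "r \<in> ?V" "x \<in> ?V" "Max ?D = dst r x" by auto
  have max: "dst u w \<le> dst r x" if "u \<in> ?V" "w \<in> ?V" for u w
    unfolding rx(3)[symmetric] using that finV by (intro Max_ge) auto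
  define l where "l = dst r"
  have lr: "l r = 0" unfolding l_def using dst_le[of r r 0] by simp
  have ex: "\<exists>u. (v, u) \<in> ?E \<and> l v = Suc (l u)" if v: "v \<in> ?V" "v \<noteq> r" for v
  proof -
    have w: "(r, v) \<in> ?E ^^ l v" unfolding l_def using walk rx(1) v(1) by simp
    then have "l v \<noteq> 0" using v(2) by (intro notI) simp
    then obtain m where m: "l v = Suc m" using not0_implies_Suc by blast
    then obtain u where u: "(r, u) \<in> ?E ^^ m" "(u, v) \<in> ?E" using w by auto
    have "l u \<le> m" unfolding l_def using dst_le[OF u(1)] .
    moreover have "(r, v) \<in> ?E ^^ Suc (l u)"
      using walk[OF rx(1) in_arcsD1[OF u(2)]] u(2) unfolding l_def by (rule relpow_Suc_I)
    then have "l v \<le> Suc (l u)" unfolding l_def using dst_le by blast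
    ultimately show ?thesis using m arcs_symmetric[OF u(2)] by (intro exI[of _ u]) simp
  qed
  \<comment> \<open>The default value \<open>r\<close> makes the root its own parent.\<close>
  define p where "p v = (if v \<in> ?V \<and> v \<noteq> r then SOME u. (v, u) \<in> ?E \<and> l v = Suc (l u) else r)" for v
  have p: "(v, p v) \<in> ?E" "l v = Suc (l (p v))" if "v \<in> ?V" "v \<noteq> r" for v
    using someI_ex[OF ex[OF that]] that by (simp_all add: p_def)
  interpret R: rooted_tree ?V r p l
  proof
    show "p r = r" by (simp add: p_def)
    show "p v \<in> ?V" if "v \<in> ?V" "v \<noteq> r" for v using in_arcsD2[OF p(1)[OF that]] .
  qed (fact finV rx(1) lr p(2))+
  have to_root: "(v, r) \<in> {(u, w) \<in> ?E. padj p u w}\<^sup>*" if "v \<in> ?V" for v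
    using that
  proof (induction "l v" arbitrary: v rule: less_induct)
    case less
    show ?case
    proof (cases "v = r")
      case False
      have "(p v, r) \<in> {(u, w) \<in> ?E. padj p u w}\<^sup>*"
        using less.hyps[of "p v"] p(2)[OF less.prems False] R.parent_in[OF less.prems False] by simp
      moreover have "(v, p v) \<in> {(u, w) \<in> ?E. padj p u w}"
        using p(1)[OF less.prems False] R.padj_parent[OF less.prems False] by simp
      ultimately show ?thesis by (rule converse_rtrancl_into_rtrancl[rotated])
    qed simp
  qed
  have sym: "sym {(u, w) \<in> ?E. padj p u w}"
  proof (rule symI)
    fix u w assume "(u, w) \<in> {(u, w) \<in> ?E. padj p u w}"
    then show "(w, u) \<in> {(u, w) \<in> ?E. padj p u w}"
      using arcs_symmetric[of u w] padj_sym[of p u w] by simp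
  qed
  have conn: "(u, w) \<in> {(u, w) \<in> ?E. padj p u w}\<^sup>*" if "u \<in> ?V" "w \<in> ?V" for u w
    using to_root[OF that(1)] symD[OF sym_rtrancl[OF sym] to_root[OF that(2)]]
    by (rule rtrancl_trans)
  have E: "(u, w) \<in> ?E \<longleftrightarrow> u \<in> ?V \<and> w \<in> ?V \<and> padj p u w" for u w
  proof
    assume uw: "(u, w) \<in> ?E"
    have V: "u \<in> ?V" "w \<in> ?V" using in_arcsD1[OF uw] in_arcsD2[OF uw] .
    have "(u, w) \<in> {(u, w) \<in> ?E. padj p u w}"
      by (rule undirected_tree_no_detour[OF T _ conn[OF V] uw]) blast
    then show "u \<in> ?V \<and> w \<in> ?V \<and> padj p u w" using V by simp
  next
    assume uw: "u \<in> ?V \<and> w \<in> ?V \<and> padj p u w"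
    then have "u \<noteq> r \<and> p u = w \<or> w \<noteq> r \<and> p w = u"
      using R.parent_root by (auto simp: padj_def)
    then show "(u, w) \<in> ?E" using p(1) arcs_symmetric uw by blast
  qed
  have "near p (l x) u x" if u: "u \<in> ?V" for u
    using R.near_iff_walk[OF E u rx(2), of "l x"] walk[OF u rx(2)] max[OF u rx(2)] by (auto simp: l_def)
  then have "end_rooted_tree ?V r p l" by (rule R.end_rooted_treeI[OF rx(2)])
  then show thesis using E by (rule that)
qed

section \<open>Distance as an infimum of walk costs, and powers of the arc relation\<close>

lemma (in pair_wf_digraph) awalk_relpow: "awalk u q v \<Longrightarrow> (u, v) \<in> parcs G ^^ length q"
proof (induction q arbitrary: u)
  case Nil
  then show ?case by (simp add: awalk_Nil_iff)
next
  case (Cons e q)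
  then have "(u, snd e) \<in> parcs G" "(snd e, v) \<in> parcs G ^^ length q"
    by (auto simp: awalk_Cons_iff)
  then show ?case using relpow_Suc_I2 by simp
qed

lemma (in pair_wf_digraph) relpow_awalk:
  "(u, v) \<in> parcs G ^^ m \<Longrightarrow> u \<in> pverts G \<Longrightarrow> \<exists>q. awalk u q v \<and> length q = m"
proof (induction m arbitrary: u)
  case 0
  then show ?case by (auto simp: awalk_Nil_iff)
next
  case (Suc m)
  then obtain w where w: "(u, w) \<in> parcs G" "(w, v) \<in> parcs G ^^ m"
    using relpow_Suc_D2 by metis
  then obtain q where "awalk w q v" "length q = m" using Suc.IH in_arcsD2 by blast
  then show ?case using w(1) by (intro exI[of _ "(u, w) # q"]) (simp add: awalk_Cons_iff)
qed

text \<open>Costs are integers: if no walk has length at most m, all have length at least m + 1, and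
  so does the infimum. This includes the case without any walk, where the infimum is
  infinite.\<close>

lemma graph_dist_le_iff:
  assumes "pair_wf_digraph G" "u \<in> pverts G"
  shows "graph_dist G u v \<le> ereal (real m) \<longleftrightarrow> (\<exists>i\<le>m. (u, v) \<in> parcs G ^^ i)"
proof -
  interpret pair_wf_digraph G by fact
  have cost: "awalk_cost (\<lambda>_. 1) q = real (length q)" for q :: "('a \<times> 'a) list"
    by (induction q) simp_all
  show ?thesis
  proof
    assume le: "graph_dist G u v \<le> ereal (real m)"
    show "\<exists>i\<le>m. (u, v) \<in> parcs G ^^ i"
    proof (rule ccontr)
      assume none: "\<not> (\<exists>i\<le>m. (u, v) \<in> parcs G ^^ i)"
      have "ereal (real (Suc m)) \<le> graph_dist G u v"
        unfolding graph_dist_def \<mu>_def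
      proof (rule INF_greatest)
        fix q assume "q \<in> {q. awalk u q v}"
        then have "\<not> length q \<le> m" using none awalk_relpow by blast
        then show "ereal (real (Suc m)) \<le> ereal (awalk_cost (\<lambda>_. 1) q)" by (simp add: cost)
      qed
      then have "ereal (real (Suc m)) \<le> ereal (real m)" using le by (rule order_trans)
      then show False by simp
    qed
  next
    assume "\<exists>i\<le>m. (u, v) \<in> parcs G ^^ i"
    then obtain q where q: "awalk u q v" "length q \<le> m" using relpow_awalk assms(2) by blast
    have "graph_dist G u v \<le> ereal (awalk_cost (\<lambda>_. 1) q)"
      unfolding graph_dist_def by (rule min_cost_le_walk_cost[OF q(1)])
    also have "\<dots> \<le> ereal (real m)" using q(2) by (simp add: cost)
    finally show "graph_dist G u v \<le> ereal (real m)" .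
  qed
qed

lemma indep_dom_iff:
  assumes "pair_graph T" "rooted_tree (pverts T) r p l"
    and E: "\<And>u w. (u, w) \<in> parcs T \<longleftrightarrow> u \<in> pverts T \<and> w \<in> pverts T \<and> padj p u w"
  shows "independent_set T S \<and> dist_dominating T d S \<longleftrightarrow> indep_dom p d (pverts T) S"
proof -
  interpret pair_graph T by fact
  interpret R: rooted_tree "pverts T" r p l by fact
  have dist: "graph_dist T u v \<le> ereal (real d) \<longleftrightarrow> near p d u v"
    if "u \<in> pverts T" "v \<in> pverts T" for u v
    using graph_dist_le_iff[OF pair_wf_digraph that(1)] R.near_iff_walk[OF E that] by simp
  show ?thesis
  proof (cases "S \<subseteq> pverts T")
    case True
    then have "independent_set T S \<longleftrightarrow> (\<forall>u\<in>S. \<forall>w\<in>S. \<not> padj p u w)"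
      using E by (simp add: independent_set_def) blast
    moreover have "dist_dominating T d S \<longleftrightarrow> (\<forall>v\<in>pverts T. \<exists>s\<in>S. near p d v s)"
    proof
      assume D: "dist_dominating T d S"
      show "\<forall>v\<in>pverts T. \<exists>s\<in>S. near p d v s"
      proof
        fix v assume v: "v \<in> pverts T"
        show "\<exists>s\<in>S. near p d v s"
        proof (cases "v \<in> S")
          case True
          then show ?thesis by (rule bexI[rotated]) simp
        next
          case False
          then obtain s where "s \<in> S" "graph_dist T v s \<le> ereal (real d)"
            using D v by (auto simp: dist_dominating_def)
          then show ?thesis using dist[OF v, of s] \<open>S \<subseteq> pverts T\<close> by blast
        qed
      qed
    next
      assume "\<forall>v\<in>pverts T. \<exists>s\<in>S. near p d v s"
      then show "dist_dominating T d S" using dist True unfolding dist_dominating_def by blast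
    qed
    ultimately show ?thesis using True by (simp add: indep_dom_def)
  qed (auto simp: independent_set_def indep_dom_def)
qed


section \<open>Coronas up to isomorphism\<close>

lemma corona_coords_indep_dom:
  assumes co: "corona_coords p d V B f" and d: "1 \<le> d"
  shows "indep_dom p d V ((\<lambda>b. f b d) ` B)"
proof -
  have "(\<lambda>b. f b d) ` B \<subseteq> V" using corona_coords_in[OF co] by auto
  moreover have "\<not> padj p (f b d) (f c d)" if "b \<in> B" "c \<in> B" for b c
    using corona_coords_padj[OF co that, of d d] d by simp
  moreover have "\<exists>s\<in>(\<lambda>b. f b d) ` B. near p d v s" if v: "v \<in> V" for v
  proof -
    obtain b i where b: "b \<in> B" "i \<le> d" "v = f b i" using corona_coords_cases[OF co v] .
    have "near p (d - i) v (f b d)"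
      using corona_coords_column_near[OF co b(1,2)] b(3) by simp
    then have "near p d v (f b d)" by (rule near_mono) simp
    then show ?thesis by (rule bexI) (use b(1) in simp)
  qed
  ultimately show ?thesis unfolding indep_dom_def by blast
qed

text \<open>The far end of a column is d steps from the base, the only exit, so whatever dominates
  it lies in the same column. Choosing such a member for each column is injective.\<close>

lemma (in rooted_tree) corona_coords_min:
  assumes co: "corona_coords p d V B f" and S: "indep_dom p d V S"
  shows "card B \<le> card S"
proof -
  define E where "E = {(u, w). u \<in> V \<and> w \<in> V \<and> padj p u w}"
  have E: "(u, w) \<in> E \<longleftrightarrow> u \<in> V \<and> w \<in> V \<and> padj p u w" for u w by (simp add: E_def)
  have column: "\<exists>i\<le>d. w = f b i \<and> d - i \<le> m" if b: "b \<in> B" and m: "m \<le> d"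
    and w: "(f b d, w) \<in> E ^^ m" for b w m
    using m w
  proof (induction m arbitrary: w)
    case 0
    then show ?case by auto
  next
    case (Suc m)
    then obtain u where u: "(f b d, u) \<in> E ^^ m" "(u, w) \<in> E" by auto
    then obtain i where i: "i \<le> d" "u = f b i" "d - i \<le> m" using Suc.IH Suc.prems(1) by auto
    obtain c j where c: "c \<in> B" "j \<le> d" "w = f c j"
      using corona_coords_cases[OF co, of w] u(2) E by blast
    have "padj p (f b i) (f c j)" using u(2) i(2) c(3) by (simp add: E)
    \<comment> \<open>After m < d steps from the far end the index is at least d - m > 0, so the
      next step still cannot leave the column.\<close>
    moreover have "i \<noteq> 0" using i(3) Suc.prems(1) by simp
    ultimately have "b = c \<and> (i = Suc j \<or> j = Suc i)"
      using corona_coords_padj[OF co b c(1) i(1) c(2)] by simp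
    then show ?case using c i(3) by (intro exI[of _ j]) auto
  qed
  have "\<exists>s\<in>S. \<exists>i\<le>d. s = f b i" if b: "b \<in> B" for b
  proof -
    have V: "f b d \<in> V" using corona_coords_in[OF co b] by simp
    then obtain s where s: "s \<in> S" "near p d (f b d) s" using S by (auto simp: indep_dom_def)
    then have "s \<in> V" using S by (auto simp: indep_dom_def)
    then obtain m where "m \<le> d" "(f b d, s) \<in> E ^^ m" using near_iff_walk[OF E V] s(2) by auto
    then show ?thesis using column[OF b] s(1) by blast
  qed
  then obtain g where g: "\<And>b. b \<in> B \<Longrightarrow> g b \<in> S \<and> (\<exists>i\<le>d. g b = f b i)" by metis
  have "inj_on g B"
  proof (rule inj_onI)
    fix b c assume bc: "b \<in> B" "c \<in> B" "g b = g c"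
    obtain i where i: "i \<le> d" "g b = f b i" using g[OF bc(1)] by blast
    obtain j where j: "j \<le> d" "g c = f c j" using g[OF bc(2)] by blast
    show "b = c" using corona_coords_eq_iff[OF co bc(1,2) i(1) j(1)] i(2) j(2) bc(3) by simp
  qed
  moreover have "finite S" using S finite_V finite_subset by (auto simp: indep_dom_def)
  moreover have "g ` B \<subseteq> S" using g by blast
  ultimately show ?thesis by (metis card_inj_on_le)
qed

text \<open>Translates column coordinates into the corona. Heights count from the base, whereas the
  copies of the path are numbered from 0 at the vertex next to it; hence the shift by one.\<close>

definition corona_vertex :: "'a \<Rightarrow> nat \<Rightarrow> 'a + 'a \<times> nat" where
  "corona_vertex b i = (case i of 0 \<Rightarrow> Inl b | Suc j \<Rightarrow> Inr (b, j))"

lemma corona_vertex_eq_iff [simp]: "corona_vertex b i = corona_vertex c j \<longleftrightarrow> b = c \<and> i = j"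
  by (auto simp: corona_vertex_def split: nat.splits)

lemma pverts_path_corona:
  "pverts (path_corona G d) = (\<lambda>(b, i). corona_vertex b i) ` (pverts G \<times> {..d})"
proof (intro set_eqI iffI)
  fix x assume "x \<in> pverts (path_corona G d)"
  then consider b where "x = Inl b" "b \<in> pverts G"
    | b i where "x = Inr (b, i)" "b \<in> pverts G" "i < d"
    by (auto simp: path_corona_def path_graph_def)
  then show "x \<in> (\<lambda>(b, i). corona_vertex b i) ` (pverts G \<times> {..d})"
  proof cases
    case (1 b)
    then show ?thesis by (intro image_eqI[of _ _ "(b, 0)"]) (simp_all add: corona_vertex_def)
  next
    case (2 b i)
    then show ?thesis by (intro image_eqI[of _ _ "(b, Suc i)"]) (simp_all add: corona_vertex_def)
  qed
qed (auto simp: path_corona_def path_graph_def corona_vertex_def split: nat.splits)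

lemma path_corona_arc_iff:
  assumes "b \<in> pverts G" "c \<in> pverts G" "i \<le> d" "j \<le> d"
  shows "(corona_vertex b i, corona_vertex c j) \<in> parcs (path_corona G d) \<longleftrightarrow>
    b = c \<and> (i = Suc j \<or> j = Suc i) \<or> i = 0 \<and> j = 0 \<and> (b, c) \<in> parcs G"
  using assms by (cases i; cases j) (auto simp: corona_vertex_def path_corona_def path_graph_def)

lemma path_corona_arcs_subset:
  assumes "pair_wf_digraph G" "1 \<le> d"
  shows "parcs (path_corona G d) \<subseteq> pverts (path_corona G d) \<times> pverts (path_corona G d)"
  using assms pair_wf_digraph.in_arcsD1[OF assms(1)] pair_wf_digraph.in_arcsD2[OF assms(1)]
  by (auto simp: path_corona_def path_graph_def)

text \<open>An isomorphism of the library carries separate maps for vertices, arcs, heads and tails.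
  With arcs as pairs, the vertex map determines the arc map.\<close>

lemma digraph_iso_with_proj_iff:
  "digraph_iso (with_proj T) (with_proj C) \<longleftrightarrow> pair_wf_digraph T \<and>
    (\<exists>h. bij_betw h (pverts T) (pverts C) \<and> parcs C = map_prod h h ` parcs T)"
proof
  assume "digraph_iso (with_proj T) (with_proj C)"
  then obtain hom where hom: "pre_digraph.digraph_isomorphism (with_proj T) hom"
    and C: "with_proj C = app_iso hom (with_proj T)" unfolding digraph_iso_def by blast
  have iso: "iso_verts hom ` pverts T = pverts C" "parcs C = iso_arcs hom ` parcs T"
    "iso_tail hom = fst" "iso_head hom = snd"
    using arg_cong[OF C, of verts] arg_cong[OF C, of arcs] arg_cong[OF C, of tail]
      arg_cong[OF C, of head] by simp_all
  have T: "pair_wf_digraph T" "inj_on (iso_verts hom) (pverts T)"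
    and arc: "\<And>e. e \<in> parcs T \<Longrightarrow>
      iso_verts hom (fst e) = fst (iso_arcs hom e) \<and> iso_verts hom (snd e) = snd (iso_arcs hom e)"
    using hom iso(3,4) by (simp_all add: pre_digraph.digraph_isomorphism_def wf_digraph_wp_iff)
  have "iso_arcs hom e = map_prod (iso_verts hom) (iso_verts hom) e" if "e \<in> parcs T" for e
    using arc[OF that] by (simp add: prod_eq_iff)
  then have "parcs C = map_prod (iso_verts hom) (iso_verts hom) ` parcs T"
    using iso(2) by (metis (no_types, lifting) image_cong)
  then show "pair_wf_digraph T \<and>
    (\<exists>h. bij_betw h (pverts T) (pverts C) \<and> parcs C = map_prod h h ` parcs T)"
    using T iso(1) by (auto simp: bij_betw_def)
next
  assume "pair_wf_digraph T \<and>
    (\<exists>h. bij_betw h (pverts T) (pverts C) \<and> parcs C = map_prod h h ` parcs T)"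
  then obtain h where T: "pair_wf_digraph T" and h: "bij_betw h (pverts T) (pverts C)"
    and C: "parcs C = map_prod h h ` parcs T" by blast
  interpret pair_wf_digraph T by fact
  let ?hom = "\<lparr> iso_verts = h, iso_arcs = map_prod h h, iso_head = snd, iso_tail = fst \<rparr>"
  have inj: "inj_on h (pverts T)" using h by (simp add: bij_betw_def)
  have "inj_on (map_prod h h) (parcs T)"
    by (rule inj_on_subset[OF map_prod_inj_on[OF inj inj]]) (use in_arcsD1 in_arcsD2 in auto)
  then have "pre_digraph.digraph_isomorphism (with_proj T) ?hom"
    using inj T by (simp add: pre_digraph.digraph_isomorphism_def wf_digraph_wp_iff)
  moreover have "with_proj C = app_iso ?hom (with_proj T)"
    using h C by (simp add: app_iso_def with_proj_def bij_betw_def)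
  ultimately show "digraph_iso (with_proj T) (with_proj C)" unfolding digraph_iso_def by blast
qed

lemma iso_path_corona_coords:
  assumes iso: "digraph_iso (with_proj T) (with_proj (path_corona G d))"
    and E: "\<And>u w. (u, w) \<in> parcs T \<longleftrightarrow> u \<in> pverts T \<and> w \<in> pverts T \<and> padj p u w"
  shows "\<exists>B f. corona_coords p d (pverts T) B f"
proof -
  let ?V = "pverts T" and ?C = "path_corona G d"
  obtain h where h: "bij_betw h ?V (pverts ?C)" and arcs: "parcs ?C = map_prod h h ` parcs T"
    using iso by (auto simp: digraph_iso_with_proj_iff)
  have inj: "inj_on h ?V" using h by (simp add: bij_betw_def)
  have arc: "padj p u w \<longleftrightarrow> (h u, h w) \<in> parcs ?C" if uw: "u \<in> ?V" "w \<in> ?V" for u w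
  proof
    assume "padj p u w"
    then have "(u, w) \<in> parcs T" using E uw by blast
    then show "(h u, h w) \<in> parcs ?C" unfolding arcs by (rule rev_image_eqI) simp
  next
    assume "(h u, h w) \<in> parcs ?C"
    then obtain u' w' where "(u', w') \<in> parcs T" "h u = h u'" "h w = h w'" unfolding arcs by auto
    then show "padj p u w" using E inj_onD[OF inj _ uw(1)] inj_onD[OF inj _ uw(2)] by metis
  qed
  define g where "g b i = inv_into ?V h (corona_vertex b i)" for b i
  have g: "g b i \<in> ?V" "h (g b i) = corona_vertex b i" if "b \<in> pverts G" "i \<le> d" for b i
  proof -
    have "corona_vertex b i \<in> h ` ?V"
      using h that by (auto simp: bij_betw_def pverts_path_corona)
    then show "g b i \<in> ?V" "h (g b i) = corona_vertex b i"
      unfolding g_def by (rule inv_into_into, rule f_inv_into_f)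
  qed
  have g_eq: "b = c \<and> i = j" if "b \<in> pverts G" "c \<in> pverts G" "i \<le> d" "j \<le> d" "g b i = g c j"
    for b c i j
  proof -
    have "corona_vertex b i = corona_vertex c j" using g(2) that by metis
    then show ?thesis by simp
  qed
  define B where "B = (\<lambda>b. g b 0) ` pverts G"
  \<comment> \<open>On \<open>B\<close> the value \<open>h b'\<close> is some \<open>Inl b\<close>,
    and \<open>projl\<close> recovers the base vertex b; elsewhere the value is irrelevant.\<close>
  define f where "f b' = g (projl (h b'))" for b'
  have f: "f (g b 0) = g b" if "b \<in> pverts G" for b
    using g(2)[OF that, of 0] by (simp add: f_def corona_vertex_def)
  have "bij_betw (\<lambda>(b, i). f b i) (B \<times> {..d}) ?V"
  proof (rule bij_betw_imageI)
    show "inj_on (\<lambda>(b, i). f b i) (B \<times> {..d})"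
    proof (rule inj_onI)
      fix s t assume st: "s \<in> B \<times> {..d}" "t \<in> B \<times> {..d}"
        "(\<lambda>(b, i). f b i) s = (\<lambda>(b, i). f b i) t"
      obtain b i where s: "s = (g b 0, i)" "b \<in> pverts G" "i \<le> d" using st(1) by (auto simp: B_def)
      obtain c j where t: "t = (g c 0, j)" "c \<in> pverts G" "j \<le> d" using st(2) by (auto simp: B_def)
      have "g b i = g c j" using st(3) s t f by simp
      then have "b = c \<and> i = j" by (rule g_eq[OF s(2) t(2) s(3) t(3)])
      then show "s = t" using s(1) t(1) by simp
    qed
    show "(\<lambda>(b, i). f b i) ` (B \<times> {..d}) = ?V"
    proof (intro equalityI subsetI)
      fix v assume "v \<in> (\<lambda>(b, i). f b i) ` (B \<times> {..d})"
      then show "v \<in> ?V" using f g(1) by (auto simp: B_def)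
    next
      fix v assume v: "v \<in> ?V"
      then have "h v \<in> pverts ?C" using h by (rule bij_betw_apply[rotated])
      then obtain b i where b: "b \<in> pverts G" "i \<le> d" "h v = corona_vertex b i"
        by (auto simp: pverts_path_corona)
      then have "v = f (g b 0) i"
        using inj_onD[OF inj, of v "g b i"] g[OF b(1,2)] v f[OF b(1)] by simp
      then show "v \<in> (\<lambda>(b, i). f b i) ` (B \<times> {..d})"
        by (intro image_eqI[of _ _ "(g b 0, i)"]) (use b in \<open>auto simp: B_def\<close>)
    qed
  qed
  moreover have "f b 0 = b" if "b \<in> B" for b using that f by (auto simp: B_def)
  moreover have "padj p (f b i) (f c j) \<longleftrightarrow>
        b = c \<and> (i = Suc j \<or> j = Suc i) \<or> i = 0 \<and> j = 0 \<and> padj p b c"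
    if bc: "b \<in> B" "c \<in> B" and ij: "i \<le> d" "j \<le> d" for b c i j
  proof -
    obtain b' where b: "b = g b' 0" "b' \<in> pverts G" using bc(1) by (auto simp: B_def)
    obtain c' where c: "c = g c' 0" "c' \<in> pverts G" using bc(2) by (auto simp: B_def)
    have "padj p (g b' i) (g c' j) \<longleftrightarrow> (corona_vertex b' i, corona_vertex c' j) \<in> parcs ?C"
      if "i \<le> d" "j \<le> d" for i j
      using arc[OF g(1)[OF b(2) that(1)] g(1)[OF c(2) that(2)]] g(2) b(2) c(2) that by simp
    then have padj_g: "padj p (g b' i) (g c' j) \<longleftrightarrow>
        b' = c' \<and> (i = Suc j \<or> j = Suc i) \<or> i = 0 \<and> j = 0 \<and> (b', c') \<in> parcs G"
      if "i \<le> d" "j \<le> d" for i j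
      using path_corona_arc_iff[OF b(2) c(2) that] that by simp
    have "b = c \<longleftrightarrow> b' = c'" using g_eq[OF b(2) c(2), of 0 0] b(1) c(1) by auto
    then show ?thesis using padj_g[OF ij] padj_g[of 0 0] f b c by simp
  qed
  ultimately show ?thesis unfolding corona_coords_def by blast
qed

text \<open>The base tree is the subgraph induced on \<open>B\<close>. It inherits acyclicity from
  \<open>T\<close>, and it is connected because a walk of \<open>T\<close> can be projected to the
  bases of the columns it visits.\<close>

lemma corona_coords_in_path_coronas:
  assumes T: "undirected_tree T" and d: "1 \<le> d"
    and E: "\<And>u w. (u, w) \<in> parcs T \<longleftrightarrow> u \<in> pverts T \<and> w \<in> pverts T \<and> padj p u w"
    and co: "corona_coords p d (pverts T) B f" and B: "2 \<le> card B"
  shows "T \<in> path_coronas d"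
proof -
  interpret pair_graph T using undirected_treeD(1)[OF T] .
  let ?V = "pverts T"
  define G where "G = \<lparr> pverts = B, parcs = parcs T \<inter> B \<times> B \<rparr>"
  have G [simp]: "pverts G = B" "parcs G = parcs T \<inter> B \<times> B" by (simp_all add: G_def)
  have BV: "b \<in> ?V" if "b \<in> B" for b
    using corona_coords_in[OF co that, of 0] corona_coords_base[OF co that] by simp
  have finB: "finite B" using B by (metis card.infinite not_numeral_le_zero)
  interpret G: pair_graph G
  proof
    show "symmetric (with_proj G)"
      using arcs_symmetric by (auto simp: symmetric_def intro!: symI)
  qed (use finB pair_finite_arcs no_loops' in auto)
  have sub: "subgraph (with_proj G) (with_proj T)"
    using BV G.wf_digraph wf_digraph by (auto simp: subgraph_def compatible_def)
  \<comment> \<open>Each step of the walk either stays in its column, leaving the projection in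
    place, or is an edge between two bases.\<close>
  have walk: "\<forall>c\<in>B. \<forall>j\<le>d. w = f c j \<longrightarrow> (u, c) \<in> rtrancl_on B (parcs G)"
    if "(u, w) \<in> rtrancl_on ?V (parcs T)" "u \<in> B" for u w
    using that
  proof (induction rule: rtrancl_on_induct)
    case base
    have "c = u" if "c \<in> B" "j \<le> d" "u = f c j" for c j
    proof -
      have "f u 0 = f c j" using corona_coords_base[OF co base(2)] that(3) by simp
      then show ?thesis using corona_coords_eq_iff[OF co base(2) that(1) _ that(2), of 0] by simp
    qed
    then show ?case using base(2) by (metis rtrancl_on.rtrancl_on_refl)
  next
    case (step y z)
    show ?case
    proof (intro ballI allI impI)
      fix c j assume c: "c \<in> B" "j \<le> d" "z = f c j"
      obtain b i where b: "b \<in> B" "i \<le> d" "y = f b i" using corona_coords_cases[OF co step(3)] .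
      have ub: "(u, b) \<in> rtrancl_on B (parcs G)" using step(5,6) b by blast
      have "padj p (f b i) (f c j)" using step(2) E b(3) c(3) by blast
      then have "b = c \<or> padj p b c" using corona_coords_padj[OF co b(1) c(1) b(2) c(2)] by blast
      then show "(u, c) \<in> rtrancl_on B (parcs G)"
      proof
        assume "padj p b c"
        then have "(b, c) \<in> parcs G" using E BV b(1) c(1) by simp
        then show ?thesis using ub c(1) by (metis rtrancl_on.rtrancl_on_into_rtrancl_on)
      qed (use ub in simp)
    qed
  qed
  have "strongly_connected (mk_symmetric (with_proj G))"
  proof
    show "verts (mk_symmetric (with_proj G)) \<noteq> {}" using B by auto
    fix u v assume "u \<in> verts (mk_symmetric (with_proj G))" "v \<in> verts (mk_symmetric (with_proj G))"
    then have uv: "u \<in> B" "v \<in> B" by simp_all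
    have "(u, v) \<in> rtrancl_on B (parcs G)"
      using walk[OF undirected_treeD(3)[OF T BV[OF uv(1)] BV[OF uv(2)]] uv(1)] uv(2)
        corona_coords_base[OF co uv(2)] by (metis le0)
    then have "u \<rightarrow>\<^sup>*\<^bsub>with_proj G\<^esub> v" by (simp add: reachable_def)
    then show "u \<rightarrow>\<^sup>*\<^bsub>mk_symmetric (with_proj G)\<^esub> v"
      using G.reachable_mk_symmetric_eq[OF G.sym_arcs] by simp
  qed
  moreover have "\<not> (\<exists>q. G.cycle q \<and> 3 \<le> length q)"
    using T subgraph_cycle[OF sub] unfolding undirected_tree_def by blast
  ultimately have treeG: "undirected_tree G"
    using G.pair_graph by (simp add: undirected_tree_def connected_def)
  let ?F = "\<lambda>(b, i). f b i" and ?cv = "\<lambda>(b, i). corona_vertex b i"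
  define h where "h = ?cv \<circ> inv_into (B \<times> {..d}) ?F"
  have bijF: "bij_betw ?F (B \<times> {..d}) ?V" using co by (simp add: corona_coords_def)
  have "bij_betw ?cv (B \<times> {..d}) (pverts (path_corona G d))"
    unfolding pverts_path_corona G by (intro bij_betw_imageI inj_onI) auto
  then have h: "bij_betw h ?V (pverts (path_corona G d))"
    unfolding h_def using bij_betw_trans[OF bij_betw_inv_into[OF bijF]] by blast
  have hf: "h (f b i) = corona_vertex b i" if "b \<in> B" "i \<le> d" for b i
    using inv_into_f_f[OF bij_betw_imp_inj_on[OF bijF], of "(b, i)"] that by (simp add: h_def)
  have arc: "(f b i, f c j) \<in> parcs T \<longleftrightarrow>
      (corona_vertex b i, corona_vertex c j) \<in> parcs (path_corona G d)"
    if "b \<in> B" "c \<in> B" "i \<le> d" "j \<le> d" for b c i j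
    using path_corona_arc_iff[of b G c i d j] corona_coords_padj[OF co that] that E BV
      corona_coords_in[OF co] by simp
  have "parcs (path_corona G d) = map_prod h h ` parcs T"
  proof (intro equalityI subsetI)
    fix e assume e: "e \<in> parcs (path_corona G d)"
    then have "e \<in> pverts (path_corona G d) \<times> pverts (path_corona G d)"
      using path_corona_arcs_subset[OF G.pair_wf_digraph d] by blast
    then obtain b i c j where bc: "e = (corona_vertex b i, corona_vertex c j)"
      "b \<in> B" "c \<in> B" "i \<le> d" "j \<le> d" by (auto simp: pverts_path_corona)
    then have "(f b i, f c j) \<in> parcs T" using arc e by simp
    then show "e \<in> map_prod h h ` parcs T"
      by (rule rev_image_eqI) (use bc hf in simp)
  next
    fix e assume "e \<in> map_prod h h ` parcs T"
    then obtain u w where uw: "(u, w) \<in> parcs T" "e = (h u, h w)" by auto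
    obtain b i where b: "b \<in> B" "i \<le> d" "u = f b i"
      using corona_coords_cases[OF co in_arcsD1[OF uw(1)]] .
    obtain c j where c: "c \<in> B" "j \<le> d" "w = f c j"
      using corona_coords_cases[OF co in_arcsD2[OF uw(1)]] .
    show "e \<in> parcs (path_corona G d)"
      using arc[OF b(1) c(1) b(2) c(2)] uw b c hf by simp
  qed
  then have "digraph_iso (with_proj T) (with_proj (path_corona G d))"
    using h pair_wf_digraph by (auto simp: digraph_iso_with_proj_iff)
  then show ?thesis using treeG B by (auto simp: path_coronas_def)
qed

theorem theorem3p4:
  fixes T :: "'a pair_pre_digraph" and d n :: nat
  assumes "2 \<le> d"
    and "undirected_tree T"
    and "card (pverts T) = n"
  shows "real (indep_dist_domination_number d T) = real n / real (d + 1)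
         \<longleftrightarrow> n = d + 1 \<or> T \<in> path_coronas d"
proof -
  let ?V = "pverts T" and ?g = "indep_dist_domination_number d T"
  obtain r p l where tree: "end_rooted_tree ?V r p l"
    and E: "\<And>u w. (u, w) \<in> parcs T \<longleftrightarrow> u \<in> ?V \<and> w \<in> ?V \<and> padj p u w"
    using undirected_tree_rooted[OF assms(2)] by metis
  interpret end_rooted_tree ?V r p l by (rule tree)
  let ?D = "card ` {S. indep_dom p d ?V S}"
  have g: "?g = Min ?D"
    unfolding indep_dist_domination_number_def
    using indep_dom_iff[OF undirected_treeD(1)[OF assms(2)] rooted_tree_axioms E] by simp
  have "{S. indep_dom p d ?V S} \<subseteq> Pow ?V" by (auto simp: indep_dom_def)
  then have fin: "finite ?D" using finite_V by (meson finite_Pow_iff finite_imageI finite_subset)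
  have gI: "?g = k" if "indep_dom p d ?V S" "card S = k" "\<And>S. indep_dom p d ?V S \<Longrightarrow> k \<le> card S"
    for S k
    unfolding g using that by (intro Min_eqI[OF fin]) auto
  have ratio: "real ?g = real n / real (d + 1) \<longleftrightarrow> n = ?g * Suc d"
  proof -
    have "real ?g = real n / real (d + 1) \<longleftrightarrow> real (?g * Suc d) = real n"
      by (simp add: field_simps)
    also have "\<dots> \<longleftrightarrow> n = ?g * Suc d" by (metis of_nat_eq_iff)
    finally show ?thesis .
  qed
  have n0: "n \<noteq> 0" using assms(3) finite_V root_in card_gt_0_iff[of ?V] by auto
  show ?thesis unfolding ratio
  proof
    assume n: "n = ?g * Suc d"
    have min: "?g \<le> card S" if "indep_dom p d ?V S" for S
      unfolding g using that by (intro Min_le[OF fin]) simp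
    have "?g \<noteq> 0" using n n0 by (metis mult_0)
    then consider "?g = 1" | "2 \<le> ?g" by linarith
    then show "n = d + 1 \<or> T \<in> path_coronas d"
    proof cases
      case 1
      then show ?thesis using n by simp
    next
      case 2
      have cV: "card ?V = ?g * Suc d" using n assms(3) by metis
      from extremal_tree_corona_coords[OF assms(1) tree cV min 2]
      obtain B f where co: "corona_coords p d ?V B f" by blast
      have "card B * Suc d = ?g * Suc d" using corona_coords_card[OF co] cV by metis
      then have "2 \<le> card B" using 2 by (simp only: mult_cancel2) simp
      then show ?thesis
        using corona_coords_in_path_coronas[OF assms(2) _ E co] assms(1) by simp
    qed
  next
    assume "n = d + 1 \<or> T \<in> path_coronas d"
    then show "n = ?g * Suc d"
    proof
      assume n: "n = d + 1"
      \<comment> \<open>The way from \<open>v\<close> to the root has \<open>l v\<close> + 1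
        distinct vertices, out of d + 1 in all.\<close>
      have "l v \<le> d" if "v \<in> ?V" for v
        using card_mono[OF finite_V chain_subset[OF that, of "l v"]] card_chain[OF that, of "l v"]
          n assms(3) by simp
      then have "indep_dom p d ?V {r}" by (rule root_indep_dom)
      moreover have "1 \<le> card S" if S: "indep_dom p d ?V S" for S
      proof -
        have "S \<noteq> {}" "finite S"
          using S root_in finite_subset[OF _ finite_V] by (auto simp: indep_dom_def)
        then show ?thesis by (simp add: Suc_le_eq card_gt_0_iff)
      qed
      ultimately have "?g = 1" by (intro gI[of "{r}"]) simp_all
      then show ?thesis using n by simp
    next
      assume "T \<in> path_coronas d"
      then obtain G :: "'a pair_pre_digraph"
        where "digraph_iso (with_proj T) (with_proj (path_corona G d))"
        unfolding path_coronas_def by blast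
      then obtain B f where co: "corona_coords p d ?V B f"
        using iso_path_corona_coords[OF _ E] by metis
      have "inj_on (\<lambda>b. f b d) B" using corona_coords_eq_iff[OF co] by (auto intro: inj_onI)
      then have "card ((\<lambda>b. f b d) ` B) = card B" by (rule card_image)
      then have "?g = card B"
        using corona_coords_indep_dom[OF co] corona_coords_min[OF co] assms(1)
        by (intro gI[of "(\<lambda>b. f b d) ` B"]) simp_all
      then show ?thesis using corona_coords_card[OF co] assms(3) by simp
    qed
  qed
qed

end
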